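(* Let $\varphi(t)$ be a smooth one-parameter family of $G_2$-structures on a smooth 7-manifold $M$ evolving by the general flow $$\frac{\partial}{\partial t}\varphi_{ijk} = h^l_i\varphi_{ljk} + h^l_j\varphi_{ilk} + h^l_k\varphi_{ijl} + X^l\psi_{lijk},$$ where $h=h(t)$ is a symmetric 2-tensor, $X=X(t)$ is a vector field, and $h^l_i = g^{lm}h_{im}$. Then the metric $g_{ij}$ determined by $\varphi(t)$ evolves by $$\frac{\partial}{\partial t}g_{ij} = 2h_{ij}.$$
   Context: Index notation in local coordinates $x^1,\dots,x^7$, with the summation convention; forms are written $\alpha=\frac{1}{k!}\alpha_{i_1\cdots i_k}dx^{i_1}\wedge\cdots\wedge dx^{i_k}$. A $G_2$-structure on a smooth 7-manifold $M$ is a smooth 3-form $\varphi$ which at each point is equivalent, under a linear isomorphism $T_xM\cong\mathbb{R}^7$, to $e^{123}+e^{145}+e^{167}+e^{246}-e^{257}-e^{347}-e^{356}$. It determines a unique Riemannian metric $g$ and orientation (volume form $\mathsf{vol}$) by the convention $(u\lrcorner\varphi)\wedge(v\lrcorner\varphi)\wedge\varphi=-6\,g(u,v)\,\mathsf{vol}$. $\psi=*\varphi$ is the Hodge dual 4-form. In the flow, $g$ and $\psi$ are those determined by $\varphi(t)$ at time $t$. *)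

theory Defs
  imports "HOL-Analysis.Analysis"
begin

section \<open>Exterior algebra on the coordinate space\<close>

text \<open>
  A covariant \<open>k\<close>-tensor on \<open>\<real>\<^sup>7\<close> is a function on lists of vectors, multilinear on lists of
  length \<open>k\<close>. It is required to vanish on lists of any other length, so that equality of
  tensors is equality of functions.
\<close>

type_synonym tensor = "(real ^ 7) list \<Rightarrow> real"

definition multilinear_form :: "nat \<Rightarrow> tensor \<Rightarrow> bool" where
  "multilinear_form k \<alpha> \<longleftrightarrow>
     (\<forall>vs. length vs = k \<longrightarrow> (\<forall>i<k. linear (\<lambda>v. \<alpha> (vs[i := v])))) \<and>
     (\<forall>vs. length vs \<noteq> k \<longrightarrow> \<alpha> vs = 0)"

definition alternating_form :: "nat \<Rightarrow> tensor \<Rightarrow> bool" where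
  "alternating_form k \<alpha> \<longleftrightarrow>
     multilinear_form k \<alpha> \<and> (\<forall>vs. \<not> distinct vs \<longrightarrow> \<alpha> vs = 0)"

definition interior_prod :: "real ^ 7 \<Rightarrow> tensor \<Rightarrow> tensor" where
  "interior_prod u \<alpha> = (\<lambda>vs. \<alpha> (u # vs))"

text \<open>
  The wedge product of a \<open>p\<close>-form and a \<open>q\<close>-form, normalised by \<open>1 / (p! q!)\<close>, so that
  \<open>e\<^sup>1 \<and> \<dots> \<and> e\<^sup>k\<close> is \<open>1\<close> on \<open>(e\<^sub>1, \<dots>, e\<^sub>k)\<close>.
\<close>

definition wedge :: "nat \<Rightarrow> nat \<Rightarrow> tensor \<Rightarrow> tensor \<Rightarrow> tensor" where
  "wedge p q \<alpha> \<beta> = (\<lambda>vs. if length vs = p + q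
     then (\<Sum>\<sigma> | \<sigma> permutes {..<p + q}. of_int (sign \<sigma>)
             * \<alpha> (map (\<lambda>i. vs ! \<sigma> i) [0..<p]) * \<beta> (map (\<lambda>i. vs ! \<sigma> i) [p..<p + q]))
          / (fact p * fact q)
     else 0)"

definition covector :: "7 \<Rightarrow> tensor" where
  "covector i = (\<lambda>vs. if length vs = 1 then hd vs $ i else 0)"

definition e3 :: "7 \<Rightarrow> 7 \<Rightarrow> 7 \<Rightarrow> tensor" where
  "e3 i j k = wedge 2 1 (wedge 1 1 (covector i) (covector j)) (covector k)"

definition component :: "tensor \<Rightarrow> 7 list \<Rightarrow> real" where
  "component \<alpha> is = \<alpha> (map (\<lambda>i. axis i 1) is)"

section \<open>Linear algebra of a \<open>G\<^sub>2\<close>-structure\<close>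

text \<open>
  The indices \<open>1, \<dots>, 7\<close> are the seven distinct elements of the numeral type \<open>7\<close>
  (where \<open>7 = 0\<close>).
\<close>

definition standard_g2 :: tensor where
  "standard_g2 = (\<lambda>vs. e3 1 2 3 vs + e3 1 4 5 vs + e3 1 6 7 vs + e3 2 4 6 vs
                     - e3 2 5 7 vs - e3 3 4 7 vs - e3 3 5 6 vs)"

definition g2_form :: "tensor \<Rightarrow> bool" where
  "g2_form \<phi> \<longleftrightarrow> alternating_form 3 \<phi> \<and>
     (\<exists>L :: real ^ 7 \<Rightarrow> real ^ 7. linear L \<and> bij L \<and> \<phi> = (\<lambda>vs. standard_g2 (map L vs)))"

definition symmetric_form :: "tensor \<Rightarrow> bool" where
  "symmetric_form b \<longleftrightarrow> multilinear_form 2 b \<and> (\<forall>u v. b [u, v] = b [v, u])"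

definition inner_product_form :: "tensor \<Rightarrow> bool" where
  "inner_product_form g \<longleftrightarrow> symmetric_form g \<and> (\<forall>v. v \<noteq> 0 \<longrightarrow> g [v, v] > 0)"

text \<open>The Riemannian volume forms of \<open>g\<close>, one for each of the two orientations.\<close>

definition metric_volume_form :: "tensor \<Rightarrow> tensor \<Rightarrow> bool" where
  "metric_volume_form g vol \<longleftrightarrow> alternating_form 7 vol \<and>
     (\<forall>bs. length bs = 7 \<and> (\<forall>i<7. \<forall>j<7. g [bs ! i, bs ! j] = (if i = j then 1 else 0))
        \<longrightarrow> \<bar>vol bs\<bar> = 1)"

definition g2_determines :: "tensor \<Rightarrow> tensor \<Rightarrow> tensor \<Rightarrow> bool" where
  "g2_determines \<phi> g vol \<longleftrightarrow> inner_product_form g \<and> metric_volume_form g vol \<and>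
     (\<forall>u v. wedge 4 3 (wedge 2 2 (interior_prod u \<phi>) (interior_prod v \<phi>)) \<phi>
            = (\<lambda>vs. - 6 * g [u, v] * vol vs))"

definition g2_metric :: "tensor \<Rightarrow> tensor" where
  "g2_metric \<phi> = (THE g. \<exists>vol. g2_determines \<phi> g vol)"

definition g2_volume :: "tensor \<Rightarrow> tensor" where
  "g2_volume \<phi> = (THE vol. g2_determines \<phi> (g2_metric \<phi>) vol)"

text \<open>The components \<open>g\<^sup>i\<^sup>j\<close> of the inverse metric.\<close>

definition inv_metric :: "tensor \<Rightarrow> 7 \<Rightarrow> 7 \<Rightarrow> real" where
  "inv_metric g i j = matrix_inv (\<chi> a b. component g [a, b]) $ i $ j"

text \<open>
  The Hodge dual of a 3-form: in components
  \<open>(*\<alpha>)\<^sub>p\<^sub>q\<^sub>r\<^sub>s = (1/3!) g\<^sup>a\<^sup>i g\<^sup>b\<^sup>j g\<^sup>c\<^sup>k \<alpha>\<^sub>a\<^sub>b\<^sub>c vol\<^sub>i\<^sub>j\<^sub>k\<^sub>p\<^sub>q\<^sub>r\<^sub>s\<close>, which is the convention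
  \<open>\<beta> \<and> *\<alpha> = \<langle>\<beta>, \<alpha>\<rangle> vol\<close>.
\<close>

definition hodge3 :: "tensor \<Rightarrow> tensor \<Rightarrow> tensor \<Rightarrow> tensor" where
  "hodge3 g vol \<alpha> = (\<lambda>vs.
     (\<Sum>a\<in>UNIV. \<Sum>b\<in>UNIV. \<Sum>c\<in>UNIV. \<Sum>i\<in>UNIV. \<Sum>j\<in>UNIV. \<Sum>k\<in>UNIV.
        inv_metric g a i * inv_metric g b j * inv_metric g c k * component \<alpha> [a, b, c]
        * vol ([axis i 1, axis j 1, axis k 1] @ vs)) / fact 3)"

definition g2_dual :: "tensor \<Rightarrow> tensor" where
  "g2_dual \<phi> = hodge3 (g2_metric \<phi>) (g2_volume \<phi>) \<phi>"

section \<open>Smooth 7-manifolds and tensor fields\<close>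

primrec C_k_on_open ::
  "nat \<Rightarrow> 'a::real_normed_vector set \<Rightarrow> ('a \<Rightarrow> 'b::real_normed_vector) \<Rightarrow> bool" where
  "C_k_on_open 0 U f \<longleftrightarrow> continuous_on U f"
| "C_k_on_open (Suc k) U f \<longleftrightarrow>
     f differentiable_on U \<and> (\<forall>v. C_k_on_open k U (\<lambda>x. frechet_derivative f (at x) v))"

text \<open>
  On a set that need not be open, smooth means locally extendable to a smooth function on an
  open set. This is what is meant at an endpoint of the time interval.
\<close>

definition smooth_on :: "'a::real_normed_vector set \<Rightarrow> ('a \<Rightarrow> 'b::real_normed_vector) \<Rightarrow> bool" where
  "smooth_on S f \<longleftrightarrow> (\<forall>x\<in>S. \<exists>W F. open W \<and> x \<in> W \<and> (\<forall>k. C_k_on_open k W F) \<and>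
                               (\<forall>y\<in>S \<inter> W. F y = f y))"

text \<open>A chart is a pair of its domain and its coordinate map.\<close>

type_synonym 'm chart = "'m set \<times> ('m \<Rightarrow> real ^ 7)"

definition chart_inv :: "'m chart \<Rightarrow> real ^ 7 \<Rightarrow> 'm" where
  "chart_inv c = inv_into (fst c) (snd c)"

definition transition :: "'m chart \<Rightarrow> 'm chart \<Rightarrow> real ^ 7 \<Rightarrow> real ^ 7" where
  "transition c d = snd d \<circ> chart_inv c"

definition smooth_7_manifold :: "'m topology \<Rightarrow> 'm chart set \<Rightarrow> bool" where
  "smooth_7_manifold M A \<longleftrightarrow> Hausdorff_space M \<and> second_countable M \<and>
     (\<Union>c\<in>A. fst c) = topspace M \<and>
     (\<forall>c\<in>A. openin M (fst c) \<and> open (snd c ` fst c) \<and>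
        homeomorphic_map (subtopology M (fst c)) (top_of_set (snd c ` fst c)) (snd c)) \<and>
     (\<forall>c\<in>A. \<forall>d\<in>A. smooth_on (snd c ` (fst c \<inter> fst d)) (transition c d))"

definition jacobian :: "'m chart \<Rightarrow> 'm chart \<Rightarrow> 'm \<Rightarrow> real ^ 7 \<Rightarrow> real ^ 7" where
  "jacobian c d p = frechet_derivative (transition c d) (at (snd c p))"

text \<open>
  A tensor field is given by its expression in every chart at every point of its domain,
  the expressions in two charts being related by the usual transformation law: \<open>T c p\<close> is
  the tensor at \<open>p\<close> read on \<open>\<real>\<^sup>7\<close> through the coordinate frame of \<open>c\<close>, so that
  \<open>component (T c p) [i, j, \<dots>]\<close> are its components in the local coordinates of \<open>c\<close>.
\<close>

definition covariant_field :: "'m chart set \<Rightarrow> nat \<Rightarrow> ('m chart \<Rightarrow> 'm \<Rightarrow> tensor) \<Rightarrow> bool" where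
  "covariant_field A k T \<longleftrightarrow>
     (\<forall>c\<in>A. \<forall>p\<in>fst c. multilinear_form k (T c p)) \<and>
     (\<forall>c\<in>A. \<forall>d\<in>A. \<forall>p\<in>fst c \<inter> fst d. \<forall>vs. T c p vs = T d p (map (jacobian c d p) vs))"

definition symmetric_2_tensor_field :: "'m chart set \<Rightarrow> ('m chart \<Rightarrow> 'm \<Rightarrow> tensor) \<Rightarrow> bool" where
  "symmetric_2_tensor_field A h \<longleftrightarrow> covariant_field A 2 h \<and>
     (\<forall>c\<in>A. \<forall>p\<in>fst c. symmetric_form (h c p)) \<and>
     (\<forall>c\<in>A. \<forall>i j. smooth_on (snd c ` fst c) (\<lambda>y. component (h c (chart_inv c y)) [i, j]))"

definition vector_field :: "'m chart set \<Rightarrow> ('m chart \<Rightarrow> 'm \<Rightarrow> real ^ 7) \<Rightarrow> bool" where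
  "vector_field A X \<longleftrightarrow>
     (\<forall>c\<in>A. \<forall>d\<in>A. \<forall>p\<in>fst c \<inter> fst d. X d p = jacobian c d p (X c p)) \<and>
     (\<forall>c\<in>A. smooth_on (snd c ` fst c) (\<lambda>y. X c (chart_inv c y)))"

text \<open>A family of \<open>G\<^sub>2\<close>-structures over the time interval \<open>I\<close>, jointly smooth in time and space.\<close>

definition smooth_g2_family ::
  "'m chart set \<Rightarrow> real set \<Rightarrow> (real \<Rightarrow> 'm chart \<Rightarrow> 'm \<Rightarrow> tensor) \<Rightarrow> bool" where
  "smooth_g2_family A I \<phi> \<longleftrightarrow>
     (\<forall>t\<in>I. covariant_field A 3 (\<phi> t)) \<and>
     (\<forall>t\<in>I. \<forall>c\<in>A. \<forall>p\<in>fst c. g2_form (\<phi> t c p)) \<and>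
     (\<forall>c\<in>A. \<forall>i j k. smooth_on (I \<times> snd c ` fst c)
                       (\<lambda>(t, y). component (\<phi> t c (chart_inv c y)) [i, j, k]))"

text \<open>The mixed components \<open>h\<^sup>l\<^sub>i = g\<^sup>l\<^sup>m h\<^sub>i\<^sub>m\<close>.\<close>

definition raise_index :: "tensor \<Rightarrow> tensor \<Rightarrow> 7 \<Rightarrow> 7 \<Rightarrow> real" where
  "raise_index g h l i = (\<Sum>m\<in>UNIV. inv_metric g l m * component h [i, m])"

end

theory Submission
  imports Defs "HOL-Library.Sublist"
begin

text \<open>
  Evaluating the defining identity on the coordinate frame expresses the metric as
  \<open>g\<^sub>i\<^sub>j = B\<^sub>i\<^sub>j / (-6 V)\<close>, where \<open>B\<close> is a polynomial in the components of \<open>\<phi>\<close> and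
  \<open>V\<^sup>9 = det B / (-6)\<^sup>7\<close>. Hence the time derivative of \<open>g\<close> depends only on that of \<open>\<phi>\<close>.
  For every \<open>X\<close>, the form \<open>X \<lrcorner> \<psi>\<close> is the derivation action on \<open>\<phi>\<close> of a \<open>g\<close>-skew
  endomorphism \<open>N\<close>, a multiple of the cross product with \<open>X\<close>. The right-hand side of the flow
  is therefore the velocity at \<open>s = 0\<close> of \<open>(id + s (h + N))\<^sup>* \<phi>\<close>, whose metric
  \<open>(id + s (h + N))\<^sup>* g\<close> has derivative \<open>2 h\<close> because the skew part cancels.
\<close>

section \<open>Multilinear and alternating forms\<close>

text \<open>Being a \<open>g2_form\<close> supplies some isomorphism \<open>L\<close> at each time,
  but nothing makes these choices differentiable in time, so \<open>g = L^T L\<close> cannot be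
  differentiated along the given family. This is why the metric is expressed by the components of
  \<phi> alone. The derivative of that expression is never expanded: it is evaluated on the
  comparison path, along which the isomorphism varies explicitly. Metric, volume form and dual are
  natural under linear isomorphisms, so the algebra is done for the standard form on the standard
  frame. Two facts remain there, and both become finite integer checks: the 7-form in the defining
  identity is a multiple of the dot product, and \<psi> contracted with a vector is a derivation
  action on \<phi>. The factor -6 of the convention forces the orientation opposite to
  \<open>e_1, ..., e_7\<close>, which is the source of the minus signs in the standard volume
  form.\<close>

lemma multilinear_form_linear:
  assumes "multilinear_form k \<alpha>" "length xs + length ys + 1 = k"
  shows "linear (\<lambda>v. \<alpha> (xs @ v # ys))"
proof -
  have "length (xs @ 0 # ys) = k" "length xs < k" using assms(2) by auto
  then have "linear (\<lambda>v. \<alpha> ((xs @ 0 # ys)[length xs := v]))"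
    using assms(1) unfolding multilinear_form_def by blast
  then show ?thesis by simp
qed

lemma multilinear_formI:
  assumes "\<And>xs ys. length xs + length ys + 1 = k \<Longrightarrow> linear (\<lambda>v. \<alpha> (xs @ v # ys))"
    and "\<And>vs. length vs \<noteq> k \<Longrightarrow> \<alpha> vs = 0"
  shows "multilinear_form k \<alpha>"
  unfolding multilinear_form_def
proof (intro conjI allI impI)
  fix vs :: "(real ^ 7) list" and i assume "length vs = k" "i < k"
  then show "linear (\<lambda>v. \<alpha> (vs[i := v]))"
    using assms(1)[of "take i vs" "drop (Suc i) vs"] by (simp add: upd_conv_take_nth_drop)
qed (use assms(2) in auto)

lemma multilinear_form_length: "multilinear_form k \<alpha> \<Longrightarrow> length vs \<noteq> k \<Longrightarrow> \<alpha> vs = 0"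
  by (simp add: multilinear_form_def)

lemma multilinear_form_pullback:
  assumes "multilinear_form k \<alpha>" "linear L"
  shows "multilinear_form k (\<lambda>vs. \<alpha> (map L vs))"
proof (rule multilinear_formI)
  fix xs ys :: "(real ^ 7) list" assume "length xs + length ys + 1 = k"
  then have "linear (\<lambda>v. \<alpha> (map L xs @ v # map L ys))"
    by (intro multilinear_form_linear[OF assms(1)]) simp
  from linear_compose[OF assms(2) this]
  show "linear (\<lambda>v. \<alpha> (map L (xs @ v # ys)))" by (simp add: o_def)
qed (use assms in \<open>auto intro: multilinear_form_length\<close>)

lemma alternating_form_multilinear: "alternating_form k \<alpha> \<Longrightarrow> multilinear_form k \<alpha>"
  by (simp add: alternating_form_def)

lemma alternating_form_not_distinct: "alternating_form k \<alpha> \<Longrightarrow> \<not> distinct vs \<Longrightarrow> \<alpha> vs = 0"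
  by (simp add: alternating_form_def)

lemma alternating_form_pullback:
  assumes "alternating_form k \<alpha>" "linear L"
  shows "alternating_form k (\<lambda>vs. \<alpha> (map L vs))"
  using multilinear_form_pullback[OF alternating_form_multilinear[OF assms(1)] assms(2)]
    alternating_form_not_distinct[OF assms(1)]
  unfolding alternating_form_def by (simp add: distinct_map)

text \<open>Polarisation: expand the value with \<open>a + b\<close> in both slots, where all terms
  with a repeated entry vanish. On lists of the wrong length both sides are 0.\<close>

lemma alternating_form_swap:
  assumes "alternating_form k \<alpha>"
  shows "\<alpha> (xs @ a # ys @ b # zs) = - \<alpha> (xs @ b # ys @ a # zs)"
proof (cases "length xs + length ys + length zs + 2 = k")
  case True
  note m = alternating_form_multilinear[OF assms]
  have 1: "\<alpha> (xs @ (u + v) # ys @ w # zs) = \<alpha> (xs @ u # ys @ w # zs) + \<alpha> (xs @ v # ys @ w # zs)" for u v w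
    using linear_add[OF multilinear_form_linear[OF m, of xs "ys @ w # zs"]] True by simp
  have 2: "\<alpha> (xs @ w # ys @ (u + v) # zs) = \<alpha> (xs @ w # ys @ u # zs) + \<alpha> (xs @ w # ys @ v # zs)" for u v w
    using linear_add[OF multilinear_form_linear[OF m, of "xs @ w # ys" "zs"]] True by simp
  have 0: "\<alpha> (xs @ w # ys @ w # zs) = 0" for w
    by (rule alternating_form_not_distinct[OF assms]) auto
  have "\<alpha> (xs @ (a + b) # ys @ (a + b) # zs) = 0" by (rule 0)
  then show ?thesis unfolding 1 2 by (simp add: 0)
qed (use multilinear_form_length[OF alternating_form_multilinear[OF assms]] in simp)

section \<open>The coordinate frame, and forms determined by their values on it\<close>

definition ax :: "nat \<Rightarrow> real ^ 7" where
  "ax i = axis (of_nat i) 1"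

text \<open>The frame \<open>ax\<close> is indexed by the naturals 1 to 7 so that coefficients of
  forms become computable integers. In the type \<open>7\<close> the index 7 is 0, and
  \<open>{1..7}\<close> meets every residue exactly once.\<close>

lemma UNIV_7: "(UNIV :: 7 set) = of_nat ` {1..7}"
proof -
  have nat: "{1..7::nat} = {1, 2, 3, 4, 5, 6, 7}" by auto
  have "x \<in> {0, 1, 2, 3, 4, 5, 6}" for x :: 7
  proof (cases x)
    case (of_int z)
    then have "z \<in> {0, 1, 2, 3, 4, 5, 6}" by auto
    then show ?thesis using of_int by auto
  qed
  moreover have seven: "(7 :: 7) = 0" by simp
  have "of_nat ` {1, 2, 3, 4, 5, 6, 7 :: nat} = {1, 2, 3, 4, 5, 6, 0 :: 7}"
    by (simp only: image_insert image_empty of_nat_1 of_nat_numeral seven)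
  ultimately show ?thesis unfolding nat by blast
qed

lemma inj_on_of_nat_7: "inj_on (of_nat :: nat \<Rightarrow> 7) {1..7}"
proof -
  have "card ((of_nat :: nat \<Rightarrow> 7) ` {1..7}) = card {1..7::nat}"
    unfolding UNIV_7[symmetric] by simp
  then show ?thesis by (intro eq_card_imp_inj_on) auto
qed

lemma sum_UNIV_7: "(\<Sum>i\<in>UNIV. f (i :: 7)) = (\<Sum>i=1..7. f (of_nat i))"
  unfolding UNIV_7 by (subst sum.reindex[OF inj_on_of_nat_7]) simp

lemma vec_axis_expansion: "(\<Sum>i\<in>UNIV. v $ i *\<^sub>R axis i 1) = v" for v :: "real ^ 'n"
  using basis_expansion[of v] by (simp add: scalar_mult_eq_scaleR)

lemma vec_7_expansion: "v = (\<Sum>i=1..7. v $ of_nat i *\<^sub>R ax i)" for v :: "real ^ 7"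
  using vec_axis_expansion[of v] unfolding sum_UNIV_7 ax_def by simp

lemma linear_eqI_ax:
  fixes f g :: "real ^ 7 \<Rightarrow> 'a :: real_vector"
  assumes "linear f" "linear g" "\<And>i. i \<in> {1..7} \<Longrightarrow> f (ax i) = g (ax i)"
  shows "f v = g v"
proof -
  have "f v = f (\<Sum>i=1..7. v $ of_nat i *\<^sub>R ax i)" using vec_7_expansion[of v] by simp
  also have "\<dots> = (\<Sum>i=1..7. v $ of_nat i *\<^sub>R g (ax i))"
    using assms by (simp add: linear_sum linear_scale)
  also have "\<dots> = g (\<Sum>i=1..7. v $ of_nat i *\<^sub>R ax i)" 
    using assms by (simp add: linear_sum linear_scale)
  also have "\<dots> = g v" using vec_7_expansion[of v] by simp
  finally show ?thesis .
qed

lemma multilinear_form_eqI_ax: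
  assumes "multilinear_form k \<alpha>" "multilinear_form k \<beta>"
    and "\<And>js. length js = k \<Longrightarrow> set js \<subseteq> {1..7} \<Longrightarrow> \<alpha> (map ax js) = \<beta> (map ax js)"
  shows "\<alpha> = \<beta>"
proof -
  \<comment> \<open>Generalised for the induction: a prefix of frame vectors grows from the left
    while the remaining slots are arbitrary.\<close>
  have *: "\<alpha> (map ax js @ vs) = \<beta> (map ax js @ vs)"
    if "length js + length vs = k" "set js \<subseteq> {1..7}" for js vs
    using that
  proof (induction vs arbitrary: js)
    case Nil then show ?case using assms(3) by simp
  next
    case (Cons v vs)
    show ?case
    proof (rule linear_eqI_ax[where f = "\<lambda>v. \<alpha> (map ax js @ v # vs)"
          and g = "\<lambda>v. \<beta> (map ax js @ v # vs)"])
      fix i :: nat assume "i \<in> {1..7}"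
      then show "\<alpha> (map ax js @ ax i # vs) = \<beta> (map ax js @ ax i # vs)"
        using Cons.IH[of "js @ [i]"] Cons.prems by simp
    qed (use Cons.prems in \<open>auto intro!: multilinear_form_linear assms\<close>)
  qed
  have "\<alpha> vs = \<beta> vs" for vs
    using *[of "[]" vs] multilinear_form_length[OF assms(1), of vs]
      multilinear_form_length[OF assms(2), of vs] by (cases "length vs = k") auto
  then show ?thesis by blast
qed

text \<open>
  The sign of the permutation taking \<open>xs\<close> to \<open>ts\<close>, with junk values unless both are distinct
  lists with the same elements.
\<close>

fun arrange_sign :: "nat list \<Rightarrow> nat list \<Rightarrow> int" where
  "arrange_sign [] xs = 1"
| "arrange_sign (t # ts) [] = 1"
| "arrange_sign (t # ts) (x # xs) =
     (if x = t then arrange_sign ts xs else - arrange_sign ts (map (\<lambda>y. if y = t then x else y) xs))"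

text \<open>Selection sort on the arguments: each mismatch at the head costs one exchange, hence one
  sign. The list \<open>acc\<close> holds the entries already in place.\<close>

lemma alternating_form_arrange:
  assumes "alternating_form k \<alpha>"
  shows "distinct xs \<Longrightarrow> distinct ts \<Longrightarrow> set xs = set ts \<Longrightarrow>
    \<alpha> (map ax (acc @ xs)) = of_int (arrange_sign ts xs) * \<alpha> (map ax (acc @ ts))"
proof (induction ts arbitrary: acc xs)
  case Nil then show ?case by simp
next
  case (Cons t ts)
  then obtain x xs' where xs: "xs = x # xs'" by (cases xs) auto
  show ?case
  proof (cases "x = t")
    case True
    with Cons.prems xs have "set xs' = set ts" by auto
    with Cons.IH[of xs' "acc @ [t]"] Cons.prems xs True show ?thesis by simp
  next
    case False
    with Cons.prems xs have "t \<in> set xs'" by auto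
    then obtain ys zs where xs': "xs' = ys @ t # zs" by (meson split_list)
    have map: "map (\<lambda>y. if y = t then x else y) xs' = ys @ x # zs"
      using Cons.prems xs xs' by (auto intro!: map_idI)
    have set: "set (ys @ x # zs) = set ts"
      using Cons.prems xs xs' False by auto
    have "\<alpha> (map ax (acc @ xs)) = - \<alpha> (map ax (acc @ t # ys @ x # zs))"
      using alternating_form_swap[OF assms, of "map ax acc" "ax x" "map ax ys" "ax t" "map ax zs"]
      by (simp add: xs xs')
    also have "\<alpha> (map ax (acc @ t # ys @ x # zs)) =
        of_int (arrange_sign ts (ys @ x # zs)) * \<alpha> (map ax (acc @ t # ts))"
      using Cons.IH[of "ys @ x # zs" "acc @ [t]"] Cons.prems xs xs' set by auto
    finally show ?thesis using False by (simp add: xs map)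
  qed
qed

lemma filter_in_subseqs: "filter P xs \<in> set (subseqs xs)"
  by (induction xs) (auto simp: Let_def)

text \<open>Sorting reduces the claim to increasing index lists, and these are the sublists of
  \<open>[1..<8]\<close>, which can be enumerated by evaluation.\<close>

lemma alternating_form_eqI:
  assumes "alternating_form k \<alpha>" "alternating_form k \<beta>"
    and "\<And>js. length js = k \<Longrightarrow> js \<in> set (subseqs [1..<8]) \<Longrightarrow> \<alpha> (map ax js) = \<beta> (map ax js)"
  shows "\<alpha> = \<beta>"
proof (rule multilinear_form_eqI_ax)
  fix js :: "nat list" assume js: "length js = k" "set js \<subseteq> {1..7}"
  show "\<alpha> (map ax js) = \<beta> (map ax js)"
  proof (cases "distinct js")
    case False
    then have "\<not> distinct (map ax js)" by (simp add: distinct_map)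
    then show ?thesis using assms(1,2) by (simp add: alternating_form_not_distinct)
  next
    case True
    let ?ts = "sort js"
    have "?ts = filter (\<lambda>i. i \<in> set js) [1..<8]"
      using True js by (intro sorted_distinct_set_unique) (auto intro: sorted_wrt_filter)
    then have "?ts \<in> set (subseqs [1..<8])"
      by (simp only: filter_in_subseqs)
    then have "\<alpha> (map ax ?ts) = \<beta> (map ax ?ts)"
      using js by (intro assms(3)) auto
    then show ?thesis
      using alternating_form_arrange[OF assms(1) True, of ?ts "[]"]
        alternating_form_arrange[OF assms(2) True, of ?ts "[]"] True by simp
  qed
qed (use assms in \<open>auto intro: alternating_form_multilinear\<close>)

section \<open>The wedge product\<close>

lemma permutes_lessThan_less:
  assumes "\<sigma> permutes {..<n}" "i < n"
  shows "\<sigma> i < n"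
  using permutes_in_image[OF assms(1), of i] assms(2) by simp

lemma map_permute_map:
  assumes "\<sigma> permutes {..<n}" "length vs = n" "set is \<subseteq> {..<n}"
  shows "map (\<lambda>i. map L vs ! \<sigma> i) is = map L (map (\<lambda>i. vs ! \<sigma> i) is)"
  using assms permutes_lessThan_less[OF assms(1)] by auto

lemma wedge_pullback:
  "wedge p q (\<lambda>vs. \<alpha> (map L vs)) (\<lambda>vs. \<beta> (map L vs)) vs = wedge p q \<alpha> \<beta> (map L vs)"
proof (cases "length vs = p + q")
  case True
  have "map (\<lambda>i. map L vs ! \<sigma> i) [0..<p] = map L (map (\<lambda>i. vs ! \<sigma> i) [0..<p])"
    "map (\<lambda>i. map L vs ! \<sigma> i) [p..<p + q] = map L (map (\<lambda>i. vs ! \<sigma> i) [p..<p + q])"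
    if "\<sigma> permutes {..<p + q}" for \<sigma>
    using True that by (intro map_permute_map[of _ "p + q"]; auto)+
  then show ?thesis
    unfolding wedge_def using True by (simp del: map_map)
qed (simp add: wedge_def)

lemma multilinear_form_sum:
  assumes "\<And>x. x \<in> S \<Longrightarrow> multilinear_form k (f x)"
  shows "multilinear_form k (\<lambda>vs. \<Sum>x\<in>S. f x vs)"
  by (rule multilinear_formI)
    (auto intro!: linear_compose_sum multilinear_form_linear assms sum.neutral multilinear_form_length)

lemma multilinear_form_scale:
  assumes "multilinear_form k \<alpha>"
  shows "multilinear_form k (\<lambda>vs. c * \<alpha> vs)"
proof (rule multilinear_formI)
  fix xs ys :: "(real ^ 7) list" assume "length xs + length ys + 1 = k"
  from linear_compose_scale_right[OF multilinear_form_linear[OF assms this], of c]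
  show "linear (\<lambda>v. c * \<alpha> (xs @ v # ys))" by simp
qed (use multilinear_form_length[OF assms] in simp)

lemma multilinear_form_mult:
  assumes "multilinear_form p \<alpha>" "multilinear_form q \<beta>"
  shows "multilinear_form (p + q) (\<lambda>vs. if length vs = p + q then \<alpha> (take p vs) * \<beta> (drop p vs) else 0)"
proof (rule multilinear_formI)
  fix xs ys :: "(real ^ 7) list" assume len: "length xs + length ys + 1 = p + q"
  show "linear (\<lambda>v. if length (xs @ v # ys) = p + q
      then \<alpha> (take p (xs @ v # ys)) * \<beta> (drop p (xs @ v # ys)) else 0)"
  proof (cases "length xs < p")
    case True
    then have "take p (xs @ v # ys) = xs @ v # take (p - Suc (length xs)) ys"
      "drop p (xs @ v # ys) = drop (p - Suc (length xs)) ys" for v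
      using take_Cons'[of "p - length xs" v ys] drop_Cons'[of "p - length xs" v ys] by auto
    moreover have "linear (\<lambda>v. \<alpha> (xs @ v # take (p - Suc (length xs)) ys))"
      using True len by (intro multilinear_form_linear[OF assms(1)]) auto
    ultimately show ?thesis
      using len linear_compose_scale_right[of "\<lambda>v. \<alpha> (xs @ v # take (p - Suc (length xs)) ys)"
          "\<beta> (drop (p - Suc (length xs)) ys)"] by (simp add: mult.commute)
  next
    case False
    have "linear (\<lambda>v. \<beta> (drop p xs @ v # ys))"
      using False len by (intro multilinear_form_linear[OF assms(2)]) auto
    then show ?thesis
      using False len linear_compose_scale_right[of "\<lambda>v. \<beta> (drop p xs @ v # ys)"
          "\<alpha> (take p xs)"] by simp
  qed
qed auto

lemma multilinear_form_permute:
  assumes "multilinear_form n \<alpha>" "\<sigma> permutes {..<n}"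
  shows "multilinear_form n (\<lambda>vs. if length vs = n then \<alpha> (map (\<lambda>i. vs ! \<sigma> i) [0..<n]) else 0)"
  unfolding multilinear_form_def
proof (intro conjI allI impI)
  fix vs :: "(real ^ 7) list" and j assume len: "length vs = n" "j < n"
  have j: "inv \<sigma> j < n"
    using permutes_lessThan_less[OF permutes_inv[OF assms(2)]] len by simp
  have inv: "inv \<sigma> j = i \<longleftrightarrow> j = \<sigma> i" for i
    using permutes_inverses[OF assms(2)] by metis
  \<comment> \<open>Slot \<open>j\<close> of \<open>vs\<close> appears in the permuted list at
    position \<open>inv \<sigma> j\<close>, so an update there is again an update of a single
    slot.\<close>
  have "map (\<lambda>i. vs[j := v] ! \<sigma> i) [0..<n] = (map (\<lambda>i. vs ! \<sigma> i) [0..<n])[inv \<sigma> j := v]" for v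
    using len permutes_lessThan_less[OF assms(2)]
    by (intro nth_equalityI) (simp_all add: nth_list_update inv[symmetric] j)
  then show "linear (\<lambda>v. if length (vs[j := v]) = n then \<alpha> (map (\<lambda>i. vs[j := v] ! \<sigma> i) [0..<n]) else 0)"
    using assms(1) j len unfolding multilinear_form_def by simp
qed auto

text \<open>If two entries coincide, composition with their transposition permutes the summands and
  reverses every sign, so the sum equals its own negative.\<close>

lemma alternating_form_antisymmetrize:
  assumes "multilinear_form n \<alpha>"
  shows "alternating_form n (\<lambda>vs. if length vs = n
    then \<Sum>\<sigma> | \<sigma> permutes {..<n}. of_int (sign \<sigma>) * \<alpha> (map (\<lambda>i. vs ! \<sigma> i) [0..<n]) else 0)"
    (is "alternating_form n ?F")
  unfolding alternating_form_def
proof (intro conjI allI impI)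
  have "multilinear_form n (\<lambda>vs. \<Sum>\<sigma> | \<sigma> permutes {..<n}. of_int (sign \<sigma>) *
      (if length vs = n then \<alpha> (map (\<lambda>i. vs ! \<sigma> i) [0..<n]) else 0))"
    by (intro multilinear_form_sum multilinear_form_scale multilinear_form_permute assms) simp
  moreover have "(\<lambda>vs. \<Sum>\<sigma> | \<sigma> permutes {..<n}. of_int (sign \<sigma>) *
      (if length vs = n then \<alpha> (map (\<lambda>i. vs ! \<sigma> i) [0..<n]) else 0)) = ?F"
    by auto
  ultimately show "multilinear_form n ?F" by simp
next
  fix vs :: "(real ^ 7) list" assume "\<not> distinct vs"
  then obtain i j where ij: "i < length vs" "j < length vs" "i \<noteq> j" "vs ! i = vs ! j"
    by (auto simp: distinct_conv_nth)
  show "?F vs = 0"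
  proof (cases "length vs = n")
    case True
    let ?f = "\<lambda>\<sigma>. of_int (sign \<sigma>) * \<alpha> (map (\<lambda>i. vs ! \<sigma> i) [0..<n])"
    let ?t = "Transposition.transpose i j"
    have t: "?t permutes {..<n}" using ij True by (intro permutes_swap_id) auto
    have "?f (?t \<circ> \<sigma>) = - ?f \<sigma>" if "\<sigma> permutes {..<n}" for \<sigma>
    proof -
      have "sign (?t \<circ> \<sigma>) = - sign \<sigma>"
        using ij permutes_imp_permutation[OF _ that] permutes_imp_permutation[OF _ t]
        by (simp add: sign_compose sign_swap_id)
      moreover have "vs ! ?t k = vs ! k" for k
        using ij by (simp add: Transposition.transpose_def)
      ultimately show ?thesis by simp
    qed
    then have "(\<Sum>\<sigma> | \<sigma> permutes {..<n}. ?f \<sigma>) = - (\<Sum>\<sigma> | \<sigma> permutes {..<n}. ?f \<sigma>)"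
      by (subst setum_permutations_compose_left[OF t]) (simp add: sum_negf)
    then show ?thesis by simp
  qed simp
qed

lemma alternating_form_scale:
  "alternating_form k \<alpha> \<Longrightarrow> alternating_form k (\<lambda>vs. c * \<alpha> vs)"
  by (simp add: alternating_form_def multilinear_form_scale)

text \<open>Up to the factor \<open>1 / (p! q!)\<close> the wedge product is the antisymmetrisation
  of the tensor product.\<close>

lemma alternating_form_wedge:
  assumes "multilinear_form p \<alpha>" "multilinear_form q \<beta>"
  shows "alternating_form (p + q) (wedge p q \<alpha> \<beta>)"
proof -
  have "wedge p q \<alpha> \<beta> = (\<lambda>vs. 1 / (fact p * fact q) * (if length vs = p + q
    then \<Sum>\<sigma> | \<sigma> permutes {..<p + q}. of_int (sign \<sigma>) *
      (\<lambda>vs. if length vs = p + q then \<alpha> (take p vs) * \<beta> (drop p vs) else 0)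
        (map (\<lambda>i. vs ! \<sigma> i) [0..<p + q]) else 0))"
    by (auto simp: wedge_def fun_eq_iff take_map drop_map mult.assoc)
  then show ?thesis
    by (simp only: alternating_form_scale[OF alternating_form_antisymmetrize[OF multilinear_form_mult[OF assms]]])
qed

lemma multilinear_form_interior_prod:
  assumes "multilinear_form (Suc k) \<alpha>"
  shows "multilinear_form k (interior_prod u \<alpha>)"
  unfolding interior_prod_def
proof (rule multilinear_formI)
  fix xs ys :: "(real ^ 7) list" assume "length xs + length ys + 1 = k"
  then show "linear (\<lambda>v. \<alpha> (u # xs @ v # ys))"
    using multilinear_form_linear[OF assms, of "u # xs" ys] by simp
qed (use multilinear_form_length[OF assms] in simp)

text \<open>The inner antisymmetrisation is absorbed by the outer one: each inner \<tau> extends to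
  seven positions, replacing \<sigma> by \<open>\<sigma> \<circ> \<tau>\<close> cancels its sign,
  and the 4! equal sums turn \<open>1 / (2! 2! 4! 3!) = 1/576\<close> into 1/24.\<close>

lemma wedge_2_2_3:
  assumes "length vs = 7"
  shows "wedge 4 3 (wedge 2 2 \<alpha> \<beta>) \<gamma> vs = (\<Sum>\<sigma> | \<sigma> permutes {..<7}. of_int (sign \<sigma>) *
    (\<alpha> [vs ! \<sigma> 0, vs ! \<sigma> 1] * \<beta> [vs ! \<sigma> 2, vs ! \<sigma> 3] * \<gamma> [vs ! \<sigma> 4, vs ! \<sigma> 5, vs ! \<sigma> 6])) / 24"
    (is "_ = (\<Sum>\<sigma> | _. of_int (sign \<sigma>) * ?F \<sigma>) / 24")
proof -
  let ?P = "{\<sigma>. \<sigma> permutes {..<7 :: nat}}" and ?Q = "{\<tau>. \<tau> permutes {..<4 :: nat}}"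
  have lists: "[0..<4] = [0, 1, 2, 3]" "[4..<7] = [4, 5, 6]" "[0..<2] = [0, 1]" "[2..<4] = [2, 3]"
    by (simp_all add: upt_rec)
  have inner: "wedge 2 2 \<alpha> \<beta> (map (\<lambda>i. vs ! \<sigma> i) [0..<4]) =
      (\<Sum>\<tau>\<in>?Q. of_int (sign \<tau>) *
        (\<alpha> [vs ! \<sigma> (\<tau> 0), vs ! \<sigma> (\<tau> 1)] * \<beta> [vs ! \<sigma> (\<tau> 2), vs ! \<sigma> (\<tau> 3)])) / 4" for \<sigma>
  proof -
    have "map (\<lambda>i. vs ! \<sigma> i) [0..<4] ! \<tau> i = vs ! \<sigma> (\<tau> i)" if "\<tau> \<in> ?Q" "i < 4" for \<tau> i
      using permutes_lessThan_less[of \<tau> 4 i] that by simp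
    then show ?thesis
      by (auto simp: wedge_def lists fact_numeral mult.assoc simp del: upt_conv_Cons intro!: sum.cong)
  qed
  have "wedge 4 3 (wedge 2 2 \<alpha> \<beta>) \<gamma> vs = (\<Sum>\<sigma>\<in>?P. of_int (sign \<sigma>) *
      ((\<Sum>\<tau>\<in>?Q. of_int (sign \<tau>) *
        (\<alpha> [vs ! \<sigma> (\<tau> 0), vs ! \<sigma> (\<tau> 1)] * \<beta> [vs ! \<sigma> (\<tau> 2), vs ! \<sigma> (\<tau> 3)])) / 4) *
      \<gamma> [vs ! \<sigma> 4, vs ! \<sigma> 5, vs ! \<sigma> 6]) / 144"
    using assms unfolding wedge_def[of 4 3] inner by (simp add: lists fact_numeral)
  also have "\<dots> = (\<Sum>\<sigma>\<in>?P. \<Sum>\<tau>\<in>?Q. of_int (sign \<sigma>) * of_int (sign \<tau>) *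
        (\<alpha> [vs ! \<sigma> (\<tau> 0), vs ! \<sigma> (\<tau> 1)] * \<beta> [vs ! \<sigma> (\<tau> 2), vs ! \<sigma> (\<tau> 3)] *
      \<gamma> [vs ! \<sigma> 4, vs ! \<sigma> 5, vs ! \<sigma> 6])) / 576"
    by (simp add: sum_distrib_left sum_distrib_right sum_divide_distrib mult_ac)
  also have "\<dots> = (\<Sum>\<tau>\<in>?Q. \<Sum>\<sigma>\<in>?P. of_int (sign \<sigma>) * of_int (sign \<tau>) *
        (\<alpha> [vs ! \<sigma> (\<tau> 0), vs ! \<sigma> (\<tau> 1)] * \<beta> [vs ! \<sigma> (\<tau> 2), vs ! \<sigma> (\<tau> 3)] *
      \<gamma> [vs ! \<sigma> 4, vs ! \<sigma> 5, vs ! \<sigma> 6])) / 576"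
    by (subst sum.swap) simp
  also have "\<dots> = (\<Sum>\<tau>\<in>?Q. \<Sum>\<sigma>\<in>?P. of_int (sign \<sigma>) * ?F \<sigma>) / 576"
  proof -
    have "(\<Sum>\<sigma>\<in>?P. of_int (sign \<sigma>) * of_int (sign \<tau>) *
        (\<alpha> [vs ! \<sigma> (\<tau> 0), vs ! \<sigma> (\<tau> 1)] * \<beta> [vs ! \<sigma> (\<tau> 2), vs ! \<sigma> (\<tau> 3)] *
          \<gamma> [vs ! \<sigma> 4, vs ! \<sigma> 5, vs ! \<sigma> 6])) = (\<Sum>\<sigma>\<in>?P. of_int (sign \<sigma>) * ?F \<sigma>)"
      if "\<tau> \<in> ?Q" for \<tau>
    proof -
      have \<tau>: "\<tau> permutes {..<4}" using that by simp
      then have \<tau>7: "\<tau> permutes {..<7}" by (rule permutes_subset) auto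
      have fixed: "\<tau> 4 = 4" "\<tau> 5 = 5" "\<tau> 6 = 6"
        using permutes_not_in[OF \<tau>] by auto
      have "sign (\<sigma> \<circ> \<tau>) = sign \<sigma> * sign \<tau>" if "\<sigma> \<in> ?P" for \<sigma>
        using that permutes_imp_permutation[OF _ \<tau>7] permutes_imp_permutation[of _ \<sigma>]
        by (auto intro!: sign_compose)
      then show ?thesis
        by (subst (2) sum_permutations_compose_right[OF \<tau>7]) (simp add: fixed)
    qed
    then show ?thesis by simp
  qed
  also have "\<dots> = (\<Sum>\<sigma>\<in>?P. of_int (sign \<sigma>) * ?F \<sigma>) / 24"
    by (simp add: card_permutations[of _ 4] fact_numeral)
  finally show ?thesis .
qed

section \<open>Signed sums over permutations as a computable recursion\<close>

definition signed_picks :: "'a list \<Rightarrow> (int \<times> 'a \<times> 'a list) list" where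
  "signed_picks xs = (case xs of [] \<Rightarrow> [] | y # ys \<Rightarrow>
     (1, y, ys) # map (\<lambda>j. (- 1, ys ! j, ys[j := y])) [0..<length ys])"

text \<open>The predicate \<open>Z\<close> marks prefixes on which \<open>F\<close> vanishes, so that their subtrees are pruned.\<close>

primrec signed_sum :: "('a list \<Rightarrow> int) \<Rightarrow> ('a list \<Rightarrow> bool) \<Rightarrow> nat \<Rightarrow> 'a list \<Rightarrow> 'a list \<Rightarrow> int" where
  "signed_sum F Z 0 acc xs = F acc"
| "signed_sum F Z (Suc n) acc xs = (if Z acc then 0
     else sum_list (map (\<lambda>(s, y, ys). s * signed_sum F Z n (acc @ [y]) ys) (signed_picks xs)))"

text \<open>A permutation of an interval factors uniquely as a transposition of the first point
  \<open>m\<close> with some \<open>b\<close>, applied after a permutation fixing \<open>m\<close>.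
  On lists this exchanges the head with another entry, which is what \<open>signed_picks\<close>
  enumerates: sign 1 for \<open>b = m\<close>, sign -1 otherwise.\<close>

lemma signed_sum_eq:
  assumes "\<And>acc ys. Z acc \<Longrightarrow> F (acc @ ys) = 0"
  shows "length xs = n \<Longrightarrow> signed_sum F Z n acc xs = (\<Sum>\<sigma> | \<sigma> permutes {length acc..<length acc + n}.
    sign \<sigma> * F (map (\<lambda>i. (acc @ xs) ! \<sigma> i) [0..<length acc + n]))"
proof (induction n arbitrary: acc xs)
  case 0
  then show ?case by (simp add: map_nth)
next
  case (Suc n)
  then obtain y ys where xs: "xs = y # ys" "length ys = n" by (cases xs) auto
  let ?m = "length acc"
  let ?S = "{\<sigma>. \<sigma> permutes {Suc ?m..<Suc ?m + n}}"
  let ?G = "\<lambda>vs \<sigma>. sign \<sigma> * F (map (\<lambda>i. vs ! \<sigma> i) [0..<?m + Suc n])"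
  show ?case
  proof (cases "Z acc")
    case True
    have "F (map (\<lambda>i. (acc @ xs) ! \<sigma> i) [0..<?m + Suc n]) = 0"
      if "\<sigma> permutes {?m..<?m + Suc n}" for \<sigma>
    proof -
      have "map (\<lambda>i. (acc @ xs) ! \<sigma> i) [0..<?m] = acc"
        using permutes_not_in[OF that] by (intro nth_equalityI) (auto simp: nth_append)
      then have "map (\<lambda>i. (acc @ xs) ! \<sigma> i) [0..<?m + Suc n] =
          acc @ map (\<lambda>i. (acc @ xs) ! \<sigma> i) [?m..<?m + Suc n]"
        by (simp only: upt_add_eq_append[OF le0] map_append)
      then show ?thesis using assms[OF True] by simp
    qed
    then show ?thesis using True by simp
  next
    case False
    have IH: "signed_sum F Z n (acc @ [z]) zs = (\<Sum>\<sigma>\<in>?S. ?G (acc @ z # zs) \<sigma>)" if "length zs = n" for z zs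
      using Suc.IH[OF that, of "acc @ [z]"] by simp
    have swap: "?G (acc @ xs) (Transposition.transpose ?m (Suc ?m + j) \<circ> \<sigma>) = - ?G (acc @ ys ! j # ys[j := y]) \<sigma>"
      if "j < n" "\<sigma> \<in> ?S" for j \<sigma>
    proof -
      let ?t = "Transposition.transpose ?m (Suc ?m + j)"
      have "sign (?t \<circ> \<sigma>) = - sign \<sigma>"
        using that permutes_imp_permutation[of _ \<sigma>] permutation_swap_id[of ?m "Suc ?m + j"]
        by (subst sign_compose) (auto simp: sign_swap_id)
      moreover have "(acc @ xs) ! ?t k = (acc @ ys ! j # ys[j := y]) ! k" for k
        using that xs by (auto simp: Transposition.transpose_def nth_append nth_Cons' nth_list_update)
      ultimately show ?thesis by simp
    qed
    have insert: "{?m..<?m + Suc n} = insert ?m {Suc ?m..<Suc ?m + n}" by auto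
    have "(\<Sum>\<sigma> | \<sigma> permutes {?m..<?m + Suc n}. ?G (acc @ xs) \<sigma>) =
      (\<Sum>b\<in>insert ?m {Suc ?m..<Suc ?m + n}. \<Sum>\<sigma>\<in>?S. ?G (acc @ xs) (Transposition.transpose ?m b \<circ> \<sigma>))"
      unfolding insert by (subst sum_over_permutations_insert) auto
    also have "\<dots> = (\<Sum>\<sigma>\<in>?S. ?G (acc @ xs) \<sigma>) +
        (\<Sum>b\<in>{Suc ?m..<Suc ?m + n}. \<Sum>\<sigma>\<in>?S. ?G (acc @ xs) (Transposition.transpose ?m b \<circ> \<sigma>))"
      by simp
    also have "(\<Sum>b\<in>{Suc ?m..<Suc ?m + n}. \<Sum>\<sigma>\<in>?S. ?G (acc @ xs) (Transposition.transpose ?m b \<circ> \<sigma>)) =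
        (\<Sum>j\<in>{0..<n}. \<Sum>\<sigma>\<in>?S. ?G (acc @ xs) (Transposition.transpose ?m (Suc ?m + j) \<circ> \<sigma>))"
      by (rule sum.reindex_bij_witness[of _ "\<lambda>j. Suc ?m + j" "\<lambda>b. b - Suc ?m"]) auto
    also have "\<dots> = (\<Sum>j\<in>{0..<n}. - signed_sum F Z n (acc @ [ys ! j]) (ys[j := y]))"
    proof (rule sum.cong)
      fix j assume j: "j \<in> {0..<n}"
      have "(\<Sum>\<sigma>\<in>?S. ?G (acc @ xs) (Transposition.transpose ?m (Suc ?m + j) \<circ> \<sigma>)) =
          (\<Sum>\<sigma>\<in>?S. - ?G (acc @ ys ! j # ys[j := y]) \<sigma>)"
        using j by (intro sum.cong[OF refl] swap) simp_all
      then show "(\<Sum>\<sigma>\<in>?S. ?G (acc @ xs) (Transposition.transpose ?m (Suc ?m + j) \<circ> \<sigma>)) =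
          - signed_sum F Z n (acc @ [ys ! j]) (ys[j := y])"
        using IH[of "ys[j := y]" "ys ! j"] xs by (simp only: sum_negf length_list_update)
    qed simp
    finally show ?thesis
      using False by (simp add: xs signed_picks_def o_def interv_sum_list_conv_sum_set_nat IH[OF xs(2)])
  qed
qed

section \<open>The standard form and its metric\<close>

lemma ax_nth:
  assumes "i \<in> {1..7}" "j \<in> {1..7}"
  shows "ax i $ of_nat j = (if i = j then 1 else 0)"
  using inj_on_of_nat_7 assms unfolding ax_def axis_def inj_on_def by auto

lemma ax_inner:
  assumes "i \<in> {1..7}" "j \<in> {1..7}"
  shows "ax i \<bullet> ax j = (if i = j then 1 else 0)"
  using inj_on_of_nat_7 assms unfolding ax_def inj_on_def by (auto simp: inner_axis_axis)

text \<open>The index triples are the lines of the Fano plane: each pair of indices lies in exactly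
  one of them.\<close>

definition g2_lines :: "(int \<times> nat \<times> nat \<times> nat) list" where
  "g2_lines = [(1, 1, 2, 3), (1, 1, 4, 5), (1, 1, 6, 7), (1, 2, 4, 6), (-1, 2, 5, 7), (-1, 3, 4, 7), (-1, 3, 5, 6)]"

text \<open>For distinct \<open>a\<close>, \<open>b\<close>, \<open>c\<close> this is the
  Levi-Civita sign of \<open>(i, j, k)\<close> relative to \<open>(a, b, c)\<close>, written as
  comparisons of naturals so that it can be evaluated.\<close>

definition e3_coeff :: "nat \<Rightarrow> nat \<Rightarrow> nat \<Rightarrow> nat \<Rightarrow> nat \<Rightarrow> nat \<Rightarrow> int" where
  "e3_coeff a b c i j k =
    (if i = a then if j = b \<and> k = c then 1 else if j = c \<and> k = b then -1 else 0
     else if i = b then if j = c \<and> k = a then 1 else if j = a \<and> k = c then -1 else 0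
     else if i = c then if j = a \<and> k = b then 1 else if j = b \<and> k = a then -1 else 0
     else 0)"

definition g2_coeff :: "nat \<Rightarrow> nat \<Rightarrow> nat \<Rightarrow> int" where
  "g2_coeff i j k = sum_list (map (\<lambda>(s, a, b, c). s * e3_coeff a b c i j k) g2_lines)"

lemma wedge_1_1: "wedge 1 1 \<alpha> \<beta> [u, v] = \<alpha> [u] * \<beta> [v] - \<alpha> [v] * \<beta> [u]"
proof -
  have 0: "{..<2 :: nat} = insert 0 {Suc 0}" by auto
  have 1: "finite {Suc 0}" "0 \<notin> {Suc 0}" by auto
  have lists: "[0..<1] = [0]" "[1..<2] = [1]"
    by (simp_all add: upt_rec)
  show ?thesis
    unfolding wedge_def one_add_one length_Cons list.size 0 sum_over_permutations_insert[OF 1] permutes_sing lists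
    by (simp add: sign_swap_id Transposition.transpose_def)
qed

lemma wedge_2_1: "wedge 2 1 \<alpha> \<beta> [u, v, w] =
   (\<alpha> [u, v] * \<beta> [w] - \<alpha> [v, u] * \<beta> [w] + \<alpha> [v, w] * \<beta> [u] - \<alpha> [w, v] * \<beta> [u]
    + \<alpha> [w, u] * \<beta> [v] - \<alpha> [u, w] * \<beta> [v]) / 2"
proof -
  have 0: "{..<3 :: nat} = insert 0 (insert (Suc 0) {2})" by auto
  have 1: "finite {Suc 0, 2}" "0 \<notin> {Suc 0, 2}" by auto
  have 2: "finite {2 :: nat}" "Suc 0 \<notin> {2}" by auto
  have lists: "[0..<2] = [0, 1]" "[2..<3] = [2]" "2 + 1 = (3 :: nat)"
    by (simp_all add: upt_rec)
  show ?thesis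
    unfolding wedge_def lists 0 sum_over_permutations_insert[OF 1]
      sum_over_permutations_insert[OF 2] permutes_sing
    by (simp add: sign_swap_id permutation_swap_id sign_compose Transposition.transpose_def)
qed

lemma e3_apply: "e3 i j k [u, v, w] =
    u $ i * (v $ j * w $ k - v $ k * w $ j) + u $ j * (v $ k * w $ i - v $ i * w $ k)
    + u $ k * (v $ i * w $ j - v $ j * w $ i)"
  unfolding e3_def wedge_2_1 wedge_1_1 by (simp add: covector_def field_simps)

lemma e3_ax:
  assumes "{a, b, c, i, j, k} \<subseteq> {1..7}" "distinct [a, b, c]"
  shows "e3 (of_nat a) (of_nat b) (of_nat c) [ax i, ax j, ax k] = of_int (e3_coeff a b c i j k)"
  using assms by (simp add: e3_apply ax_nth e3_coeff_def del: One_nat_def)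

lemma multilinear_form_covector: "multilinear_form 1 (covector i)"
  by (rule multilinear_formI) (auto simp: covector_def bounded_linear.linear[OF bounded_linear_vec_nth])

lemma alternating_form_e3: "alternating_form 3 (e3 i j k)"
proof -
  have "multilinear_form 2 (wedge 1 1 (covector i) (covector j))"
    using alternating_form_wedge[OF multilinear_form_covector multilinear_form_covector]
    by (auto dest: alternating_form_multilinear simp: numeral_2_eq_2)
  from alternating_form_wedge[OF this multilinear_form_covector] show ?thesis
    by (simp add: e3_def)
qed

lemma standard_g2_lines: "standard_g2 vs =
    (\<Sum>(s, a, b, c)\<leftarrow>g2_lines. of_int s * e3 (of_nat a) (of_nat b) (of_nat c) vs)"
  by (simp add: standard_g2_def g2_lines_def)

lemma multilinear_form_sum_list:
  "(\<And>x. x \<in> set xs \<Longrightarrow> multilinear_form k (f x)) \<Longrightarrow> multilinear_form k (\<lambda>vs. \<Sum>x\<leftarrow>xs. f x vs)"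
proof (induction xs)
  case Nil
  then show ?case by (auto simp: multilinear_form_def intro: linear_zero)
next
  case (Cons x xs)
  then have "multilinear_form k (f x)" "multilinear_form k (\<lambda>vs. \<Sum>x\<leftarrow>xs. f x vs)" by auto
  then show ?case
    by (auto simp: multilinear_form_def intro!: linear_compose_add)
qed

lemma alternating_form_sum_list:
  assumes "\<And>x. x \<in> set xs \<Longrightarrow> alternating_form k (f x)"
  shows "alternating_form k (\<lambda>vs. \<Sum>x\<leftarrow>xs. f x vs)"
proof -
  have "(\<Sum>x\<leftarrow>xs. f x vs) = (\<Sum>x\<leftarrow>xs. 0)" if "\<not> distinct vs" for vs
    using alternating_form_not_distinct[OF assms that]
    by (intro arg_cong[where f = sum_list] map_cong) auto
  then show ?thesis
    using multilinear_form_sum_list[of xs k f] alternating_form_multilinear[OF assms]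
    unfolding alternating_form_def by simp
qed

lemma alternating_form_standard_g2: "alternating_form 3 standard_g2"
proof -
  have "alternating_form 3 (\<lambda>vs. \<Sum>x\<leftarrow>g2_lines.
      (case x of (s, a, b, c) \<Rightarrow> \<lambda>vs. of_int s * e3 (of_nat a) (of_nat b) (of_nat c) vs) vs)"
    by (rule alternating_form_sum_list)
      (auto intro: alternating_form_scale alternating_form_e3)
  then show ?thesis
    by (subst ext[OF standard_g2_lines]) (simp add: case_prod_unfold)
qed

lemma sum_list_of_int: "(\<Sum>x\<leftarrow>xs. of_int (f x)) = (of_int (\<Sum>x\<leftarrow>xs. f x) :: real)"
  by (induction xs) auto

lemma standard_g2_ax:
  assumes "{i, j, k} \<subseteq> {1..7}"
  shows "standard_g2 [ax i, ax j, ax k] = of_int (g2_coeff i j k)"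
proof -
  have "e3 (of_nat a) (of_nat b) (of_nat c) [ax i, ax j, ax k] = of_int (e3_coeff a b c i j k)"
    if "(s, a, b, c) \<in> set g2_lines" for s a b c
    using that assms by (intro e3_ax) (auto simp: g2_lines_def)
  then show ?thesis
    unfolding standard_g2_lines g2_coeff_def sum_list_of_int[symmetric]
    by (intro arg_cong[where f = sum_list] map_cong) auto
qed

section \<open>The volume form of the standard structure\<close>

definition index_7 :: "7 \<Rightarrow> nat" where
  "index_7 = inv_into {1..7} of_nat"

lemma index_7: "index_7 a \<in> {1..7}" "of_nat (index_7 a) = a"
  using inv_into_into[of a of_nat "{1..7}"] f_inv_into_f[of a of_nat "{1..7}"] UNIV_7
  unfolding index_7_def by auto

lemma index_7_of_nat: "i \<in> {1..7} \<Longrightarrow> index_7 (of_nat i) = i"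
  unfolding index_7_def by (rule inv_into_f_f[OF inj_on_of_nat_7])

text \<open>The minus sign is forced by the convention: for the standard form and
  \<open>u = v = e_1\<close> the wedge in the defining identity is +6 on
  \<open>e_1, ..., e_7\<close>, while it has to equal \<open>-6 vol\<close>. The shift
  \<open>index_7 a - 1\<close> converts frame indices 1 to 7 into list positions 0 to 6.\<close>

definition std_volume :: tensor where
  "std_volume vs = (if length vs = 7 then - det (\<chi> a. vs ! (index_7 a - 1)) else 0)"

lemma alternating_form_std_volume: "alternating_form 7 std_volume"
  unfolding alternating_form_def multilinear_form_def
proof (intro conjI allI impI)
  fix vs :: "(real ^ 7) list" and i :: nat assume "length vs = 7" "i < 7"
  define k :: 7 where "k = of_nat (Suc i)"
  have "vs[i := v] ! (index_7 a - 1) = (if a = k then v else vs ! (index_7 a - 1))" for a v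
  proof -
    have "index_7 a - 1 = i \<longleftrightarrow> a = k"
      using index_7[of a] index_7_of_nat[of "Suc i"] \<open>i < 7\<close> unfolding k_def by auto
    then show ?thesis using \<open>length vs = 7\<close> \<open>i < 7\<close> by auto
  qed
  then have *: "std_volume (vs[i := v]) = - det (\<chi> a. if a = k then v else vs ! (index_7 a - 1))" for v
    using \<open>length vs = 7\<close> by (simp add: std_volume_def)
  have "det (\<chi> a. if a = k then r *\<^sub>R v else vs ! (index_7 a - 1)) =
      r * det (\<chi> a. if a = k then v else vs ! (index_7 a - 1))" for r :: real and v
    using det_row_mul[of k r "\<lambda>_. v" "\<lambda>a. vs ! (index_7 a - 1)"] by (simp add: scalar_mult_eq_scaleR cong: if_cong)
  then show "linear (\<lambda>v. std_volume (vs[i := v]))"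
    unfolding * by (intro linearI) (simp_all add: det_row_add[of k "\<lambda>_. _" "\<lambda>_. _"])
next
  fix vs :: "(real ^ 7) list" assume "\<not> distinct vs"
  then obtain i j where ij: "i < length vs" "j < length vs" "i \<noteq> j" "vs ! i = vs ! j"
    by (auto simp: distinct_conv_nth)
  show "std_volume vs = 0"
  proof (cases "length vs = 7")
    case True
    have "det (\<chi> a. vs ! (index_7 a - 1)) = 0"
    proof (rule det_identical_rows)
      show "of_nat (Suc i) \<noteq> (of_nat (Suc j) :: 7)"
        using inj_onD[OF inj_on_of_nat_7, of "Suc i" "Suc j"] ij True by auto
      show "row (of_nat (Suc i)) (\<chi> a. vs ! (index_7 a - 1)) = row (of_nat (Suc j)) (\<chi> a. vs ! (index_7 a - 1))"
        using ij True index_7_of_nat[of "Suc i"] index_7_of_nat[of "Suc j"]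
        by (simp add: row_def del: of_nat_Suc)
    qed
    then show ?thesis by (simp add: std_volume_def)
  qed (simp add: std_volume_def)
qed (simp add: std_volume_def)

lemma std_volume_ax: "std_volume (map ax [1..<8]) = - 1"
proof -
  have "map ax [1..<8] ! (index_7 a - 1) = axis a 1" for a
  proof -
    have "map ax [1..<8] ! (index_7 a - 1) = ax (index_7 a)"
      using index_7(1)[of a] by (auto simp del: upt_rec_numeral)
    then show ?thesis by (simp add: ax_def index_7)
  qed
  then have "(\<chi> a. map ax [1..<8] ! (index_7 a - 1)) = (mat 1 :: real ^ 7 ^ 7)"
    by (simp add: mat_def axis_def vec_eq_iff)
  then show ?thesis by (simp add: std_volume_def)
qed

lemma std_volume_orthonormal:
  assumes "length bs = 7" "\<forall>i<7. \<forall>j<7. bs ! i \<bullet> bs ! j = (if i = j then 1 else 0)"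
  shows "\<bar>std_volume bs\<bar> = 1"
proof -
  let ?A = "\<chi> a. bs ! (index_7 a - 1)"
  have "bs ! (index_7 a - 1) \<bullet> bs ! (index_7 b - 1) = (if a = b then 1 else 0)" for a b
  proof -
    have "index_7 a - 1 = index_7 b - 1 \<longleftrightarrow> a = b"
      using index_7[of a] index_7[of b] by (metis atLeastAtMost_iff le_add_diff_inverse)
    then show ?thesis using assms(2) index_7(1)[of a] index_7(1)[of b] by auto
  qed
  then have "orthogonal_matrix ?A"
    unfolding orthogonal_matrix_orthonormal_rows by (simp add: row_def norm_eq_sqrt_inner orthogonal_def)
  from det_orthogonal_matrix[OF this] show ?thesis
    using assms(1) by (auto simp: std_volume_def)
qed

lemma std_volume_map_ax:
  assumes "length js = 7" "set js \<subseteq> {1..7}"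
  shows "std_volume (map ax js) = of_int (if distinct js then - arrange_sign [1..<8] js else 0)"
proof (cases "distinct js")
  case True
  then have "set js = set [1..<8]"
    using assms by (intro card_subset_eq) (auto simp: distinct_card)
  from alternating_form_arrange[OF alternating_form_std_volume True _ this, of "[]"] True
  show ?thesis by (simp add: std_volume_ax del: upt_rec_numeral One_nat_def)
next
  case False
  then show ?thesis
    using alternating_form_not_distinct[OF alternating_form_std_volume, of "map ax js"]
    by (simp add: distinct_map)
qed

text \<open>The three coefficients read positions 0-1, 2-3 and 4-6, so a vanishing first or second
  factor is known after two or four picks. Each index lies on three lines, so only 6 of the 42
  possible first pairs survive; this keeps the sum over 7! permutations small.\<close>

definition g2_gram_sum :: "nat \<Rightarrow> nat \<Rightarrow> int" where
  "g2_gram_sum i j = signed_sum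
    (\<lambda>js. g2_coeff i (js ! 0) (js ! 1) * g2_coeff j (js ! 2) (js ! 3) * g2_coeff (js ! 4) (js ! 5) (js ! 6))
    (\<lambda>js. length js = 2 \<and> g2_coeff i (js ! 0) (js ! 1) = 0 \<or> length js = 4 \<and> g2_coeff j (js ! 2) (js ! 3) = 0)
    7 [] [1..<8]"

text \<open>
  Here \<open>144 = 6 \<cdot> 24\<close>, with \<open>24\<close> the normalisation in \<open>wedge_2_2_3\<close>. The argument is a pair
  because \<open>code_simp\<close> would expand the body of \<open>\<lambda>i j. \<dots>\<close> with symbolic indices.
\<close>

definition g2_gram_sum_correct :: "nat \<times> nat \<Rightarrow> bool" where
  "g2_gram_sum_correct = (\<lambda>(i, j). g2_gram_sum i j = (if i = j then 144 else 0))"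

lemma g2_gram_sum_correct: "list_all g2_gram_sum_correct (List.product [1..<8] [1..<8])"
  by code_simp

section \<open>The 7-form valued pairing of vectors defined by a 3-form\<close>

definition g2_gram :: "tensor \<Rightarrow> real ^ 7 \<Rightarrow> real ^ 7 \<Rightarrow> tensor" where
  "g2_gram \<phi> u v = wedge 4 3 (wedge 2 2 (interior_prod u \<phi>) (interior_prod v \<phi>)) \<phi>"

lemma alternating_form_g2_gram:
  assumes "multilinear_form 3 \<phi>"
  shows "alternating_form 7 (g2_gram \<phi> u v)"
proof -
  have m: "multilinear_form 2 (interior_prod w \<phi>)" for w
    using assms by (intro multilinear_form_interior_prod) (simp add: eval_nat_numeral)
  have "multilinear_form 4 (wedge 2 2 (interior_prod u \<phi>) (interior_prod v \<phi>))"
    using alternating_form_multilinear[OF alternating_form_wedge[OF m m]] by simp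
  from alternating_form_wedge[OF this assms] show ?thesis
    by (simp add: g2_gram_def)
qed

lemma g2_gram_pullback: "g2_gram (\<lambda>vs. \<phi> (map L vs)) u v = (\<lambda>vs. g2_gram \<phi> (L u) (L v) (map L vs))"
proof -
  have i: "interior_prod w (\<lambda>vs. \<phi> (map L vs)) = (\<lambda>vs. interior_prod (L w) \<phi> (map L vs))" for w
    by (simp add: interior_prod_def)
  show ?thesis
    unfolding g2_gram_def i wedge_pullback[abs_def] by simp
qed

lemma g2_gram_apply:
  assumes "length vs = 7"
  shows "g2_gram \<phi> u v vs = (\<Sum>\<sigma> | \<sigma> permutes {..<7}. of_int (sign \<sigma>) *
    (\<phi> [u, vs ! \<sigma> 0, vs ! \<sigma> 1] * \<phi> [v, vs ! \<sigma> 2, vs ! \<sigma> 3] * \<phi> [vs ! \<sigma> 4, vs ! \<sigma> 5, vs ! \<sigma> 6])) / 24"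
  using assms by (simp add: g2_gram_def wedge_2_2_3 interior_prod_def)

lemma linear_3_slots:
  assumes "multilinear_form 3 \<phi>"
  shows "linear (\<lambda>u. \<phi> [u, v, w])" "linear (\<lambda>u. \<phi> [v, u, w])" "linear (\<lambda>u. \<phi> [v, w, u])"
  using multilinear_form_linear[OF assms, of "[]" "[v, w]"]
    multilinear_form_linear[OF assms, of "[v]" "[w]"]
    multilinear_form_linear[OF assms, of "[v, w]" "[]"] by simp_all

lemma bilinear_g2_gram:
  assumes "multilinear_form 3 \<phi>"
  shows "bilinear (\<lambda>u v. g2_gram \<phi> u v vs)"
proof (cases "length vs = 7")
  case False
  then show ?thesis
    using multilinear_form_length[OF alternating_form_multilinear[OF alternating_form_g2_gram[OF assms]]]
    by (simp add: bilinear_def linear_zero)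
next
  case True
  show ?thesis
    unfolding g2_gram_apply[OF True] bilinear_def
    by (intro conjI allI linearI)
      (simp_all add: linear_add[OF linear_3_slots(1)[OF assms]] linear_scale[OF linear_3_slots(1)[OF assms]]
        ring_distribs sum.distrib add_divide_distrib sum_distrib_left mult_ac)
qed

lemma g2_gram_standard_ax:
  assumes "i \<in> {1..7}" "j \<in> {1..7}"
  shows "g2_gram standard_g2 (ax i) (ax j) (map ax [1..<8]) = (if i = j then 6 else 0)"
proof -
  let ?js = "[1..<8] :: nat list"
  let ?F = "\<lambda>js :: nat list. g2_coeff i (js ! 0) (js ! 1) * g2_coeff j (js ! 2) (js ! 3) * g2_coeff (js ! 4) (js ! 5) (js ! 6)"
  let ?f = "\<lambda>\<sigma>. of_int (sign \<sigma>) *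
    (standard_g2 [ax i, map ax ?js ! \<sigma> 0, map ax ?js ! \<sigma> 1] * standard_g2 [ax j, map ax ?js ! \<sigma> 2, map ax ?js ! \<sigma> 3]
     * standard_g2 [map ax ?js ! \<sigma> 4, map ax ?js ! \<sigma> 5, map ax ?js ! \<sigma> 6])"
  have "?f \<sigma> = of_int (sign \<sigma> * ?F (map (\<lambda>i. ?js ! \<sigma> i) [0..<7]))" if \<sigma>: "\<sigma> permutes {..<7}" for \<sigma>
  proof -
    \<comment> \<open>Permutations act on the positions 0 to 6, while the frame indices in
      \<open>ks\<close> run from 1 to 7.\<close>
    define ks where "ks = map (\<lambda>i. ?js ! \<sigma> i) [0..<7]"
    have "map ax ?js ! \<sigma> k = ax (ks ! k)" "ks ! k \<in> {1..7}" if "k < 7" for k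
      using permutes_lessThan_less[OF \<sigma> that] that
      by (auto simp: ks_def simp del: upt_rec_numeral)
    note nth = this[of 0] this[of 1] this[of 2] this[of 3] this[of 4] this[of 5] this[of 6]
    show ?thesis
      unfolding ks_def[symmetric] using assms nth(2,4,6,8,10,12,14)
      by (simp add: nth(1,3,5,7,9,11,13) standard_g2_ax del: upt_rec_numeral One_nat_def)
  qed
  then have "g2_gram standard_g2 (ax i) (ax j) (map ax ?js) =
      of_int (\<Sum>\<sigma> | \<sigma> permutes {..<7}. sign \<sigma> * ?F (map (\<lambda>i. ?js ! \<sigma> i) [0..<7])) / 24"
    by (subst g2_gram_apply) (simp_all del: upt_rec_numeral)
  also have "(\<Sum>\<sigma> | \<sigma> permutes {..<7}. sign \<sigma> * ?F (map (\<lambda>i. ?js ! \<sigma> i) [0..<7])) = g2_gram_sum i j"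
    unfolding g2_gram_sum_def
    by (subst signed_sum_eq) (auto simp: nth_append lessThan_atLeast0 simp del: upt_rec_numeral)
  also have "\<dots> = (if i = j then 144 else 0)"
    using g2_gram_sum_correct assms
    by (auto simp: list_all_iff g2_gram_sum_correct_def simp del: upt_rec_numeral)
  finally show ?thesis by (cases "i = j") simp_all
qed

text \<open>A 7-form in seven dimensions is fixed by its value on the frame, and both sides are
  bilinear in \<open>u\<close> and \<open>v\<close>, so the 49 evaluated cases suffice.\<close>

lemma g2_gram_standard: "g2_gram standard_g2 u v = (\<lambda>vs. - 6 * (u \<bullet> v) * std_volume vs)"
proof (rule alternating_form_eqI)
  note m = alternating_form_multilinear[OF alternating_form_standard_g2]
  show "alternating_form 7 (g2_gram standard_g2 u v)"
    by (rule alternating_form_g2_gram[OF m])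
  show "alternating_form 7 (\<lambda>vs. - 6 * (u \<bullet> v) * std_volume vs)"
    by (rule alternating_form_scale[OF alternating_form_std_volume])
  fix js :: "nat list" assume js: "length js = 7" "js \<in> set (subseqs [1..<8])"
  have "js = [1..<8]"
    using js subseq_same_length[of js "[1..<8]"] by (simp del: upt_rec_numeral)
  have b: "bilinear (\<lambda>u v. g2_gram standard_g2 u v (map ax js))" by (rule bilinear_g2_gram[OF m])
  have c: "bilinear (\<lambda>u v. - 6 * (u \<bullet> v) * std_volume (map ax js))"
    by (auto simp: bilinear_def algebra_simps intro!: linearI)
  show "g2_gram standard_g2 u v (map ax js) = - 6 * (u \<bullet> v) * std_volume (map ax js)"
  proof (rule fun_cong[OF fun_cong[OF bilinear_eq_stdbasis[OF b c]]])
    fix e f :: "real ^ 7" assume "e \<in> Basis" "f \<in> Basis"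
    then obtain a b :: 7 where "e = axis a 1" "f = axis b 1"
      by (auto simp: Basis_vec_def)
    then have ef: "e = ax (index_7 a)" "f = ax (index_7 b)"
      by (simp_all add: ax_def index_7)
    show "g2_gram standard_g2 e f (map ax js) = - 6 * (e \<bullet> f) * std_volume (map ax js)"
      unfolding ef \<open>js = _\<close> std_volume_ax g2_gram_standard_ax[OF index_7(1) index_7(1)]
        ax_inner[OF index_7(1) index_7(1)] by simp
  qed
qed

section \<open>Metric and volume form of a pulled-back standard form\<close>

lemma g2_determines_pullback:
  assumes "linear L" "bij L"
  shows "g2_determines (\<lambda>vs. standard_g2 (map L vs))
    (\<lambda>vs. if length vs = 2 then L (vs ! 0) \<bullet> L (vs ! 1) else 0) (\<lambda>vs. std_volume (map L vs))"
  unfolding g2_determines_def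
proof (intro conjI allI)
  let ?g = "\<lambda>vs. if length vs = 2 then L (vs ! 0) \<bullet> L (vs ! 1) else 0"
  have "multilinear_form 2 ?g"
  proof (rule multilinear_formI)
    fix xs ys :: "(real ^ 7) list" assume "length xs + length ys + 1 = 2"
    then consider y where "xs = []" "ys = [y]" | x where "xs = [x]" "ys = []"
      by (cases xs; cases ys) auto
    then show "linear (\<lambda>v. ?g (xs @ v # ys))"
      by cases (auto intro!: linearI simp: linear_add[OF assms(1)] linear_scale[OF assms(1)] inner_add_left inner_add_right)
  qed simp
  moreover have "L v \<noteq> 0" if "v \<noteq> 0" for v
    using that assms linear_0[OF assms(1)] bij_is_inj[OF assms(2)] by (metis injD)
  ultimately show "inner_product_form ?g"
    by (auto simp: inner_product_form_def symmetric_form_def inner_commute)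
  show "metric_volume_form ?g (\<lambda>vs. std_volume (map L vs))"
    unfolding metric_volume_form_def
    by (auto intro!: alternating_form_pullback alternating_form_std_volume assms std_volume_orthonormal)
  show "wedge 4 3 (wedge 2 2 (interior_prod u (\<lambda>vs. standard_g2 (map L vs))) (interior_prod v (\<lambda>vs. standard_g2 (map L vs))))
        (\<lambda>vs. standard_g2 (map L vs)) = (\<lambda>vs. - 6 * ?g [u, v] * std_volume (map L vs))" for u v
    using g2_gram_pullback[of standard_g2 L u v] unfolding g2_gram_def[symmetric] g2_gram_standard by simp
qed

lemma multilinear_form_scale_all:
  assumes "multilinear_form k \<alpha>"
  shows "\<alpha> (map (\<lambda>v. c *\<^sub>R v) vs) = c ^ k * \<alpha> vs"
proof -
  have *: "length xs + length ys = k \<Longrightarrow> \<alpha> (xs @ map (\<lambda>v. c *\<^sub>R v) ys) = c ^ length ys * \<alpha> (xs @ ys)" for xs ys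
  proof (induction ys arbitrary: xs)
    case (Cons y ys)
    then show ?case
      using Cons.IH[of "xs @ [c *\<^sub>R y]"] linear_scale[OF multilinear_form_linear[OF assms, of xs ys], of c y] by simp
  qed simp
  show ?thesis
    using *[of "[]" vs] multilinear_form_length[OF assms] by (cases "length vs = k") auto
qed

text \<open>Two solutions have proportional metrics, since the defining identity prescribes the
  product of metric and volume form. If \<open>k\<close> is the factor, normalising the volume on an
  orthonormal basis gives \<open>k^(9/2) = 1\<close>: the seven arguments contribute
  \<open>k^(7/2)\<close> and the identity itself contributes \<open>k\<close>.\<close>

lemma g2_determines_unique:
  assumes "linear L" "bij L" "g2_determines (\<lambda>vs. standard_g2 (map L vs)) g vol"
  shows "g = (\<lambda>vs. if length vs = 2 then L (vs ! 0) \<bullet> L (vs ! 1) else 0)" (is "g = ?g")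
    and "vol = (\<lambda>vs. std_volume (map L vs))"
proof -
  have eq: "g [u, v] * vol vs = (L u \<bullet> L v) * std_volume (map L vs)" for u v vs
  proof -
    have "(\<lambda>vs. - 6 * g [u, v] * vol vs) = (\<lambda>vs. - 6 * ?g [u, v] * std_volume (map L vs))"
      using assms(3) g2_determines_pullback[OF assms(1,2)] unfolding g2_determines_def by metis
    from fun_cong[OF this, of vs] show ?thesis by simp
  qed
  have g: "inner_product_form g" and vol: "metric_volume_form g vol"
    using assms(3) by (auto simp: g2_determines_def)
  then have m: "multilinear_form 2 g" and pos: "\<And>v. v \<noteq> 0 \<Longrightarrow> g [v, v] > 0"
    by (auto simp: inner_product_form_def symmetric_form_def)
  have alt: "alternating_form 7 vol" using vol by (simp add: metric_volume_form_def)
  let ?bs = "map (inv L) (map ax [1..<8])"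
  have surj: "L (inv L v) = v" for v
    using assms(2) by (simp add: bij_is_surj surj_f_inv_f)
  then have "map L ?bs = map ax [1..<8]" by (simp add: o_def del: upt_rec_numeral)
  then have bs: "std_volume (map L ?bs) = - 1" using std_volume_ax by metis
  \<comment> \<open>On the preimage \<open>?bs\<close> of the standard frame
    \<open>std_volume\<close> is -1, so \<open>eq\<close> at \<open>?bs\<close> makes
    \<open>k\<close> the factor between the two metrics.\<close>
  define k where "k = - vol ?bs"
  have gk: "g [u, v] * k = L u \<bullet> L v" for u v
    using eq[of u v ?bs] unfolding bs k_def by simp
  have "k > 0"
  proof -
    let ?v = "inv L (ax 1)"
    have "g [?v, ?v] * k = 1" using gk[of ?v ?v] by (simp add: surj ax_inner del: One_nat_def)
    moreover have "?v \<noteq> 0"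
    proof
      assume "?v = 0"
      then have "ax 1 = 0" using surj[of "ax 1"] linear_0[OF assms(1)] by simp
      then show False using ax_inner[of 1 1] by simp
    qed
    ultimately show ?thesis using pos[of ?v] zero_less_mult_pos[of "g [?v, ?v]" k] by simp
  qed
  \<comment> \<open>\<open>?bs\<close> is orthonormal for the pulled-back metric, hence its multiple
    by \<open>sqrt k\<close> is orthonormal for \<open>g\<close>.\<close>
  let ?cs = "map (\<lambda>v. sqrt k *\<^sub>R v) ?bs"
  have "g [?cs ! i, ?cs ! j] = (if i = j then 1 else 0)" if "i < 7" "j < 7" for i j
  proof -
    have L: "L (?cs ! i) = sqrt k *\<^sub>R ax (Suc i)" if "i < 7" for i
      using that by (simp add: linear_scale[OF assms(1)] surj del: upt_rec_numeral)
    have "g [?cs ! i, ?cs ! j] * k = k * (ax (Suc i) \<bullet> ax (Suc j))"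
      unfolding gk L[OF that(1)] L[OF that(2)] using \<open>k > 0\<close> by simp
    then show ?thesis using that \<open>k > 0\<close> by (simp add: ax_inner split: if_splits)
  qed
  then have "\<bar>vol ?cs\<bar> = 1"
    using vol unfolding metric_volume_form_def by (auto simp del: upt_rec_numeral)
  then have "sqrt k ^ 7 * k = 1"
    using multilinear_form_scale_all[OF alternating_form_multilinear[OF alt], of "sqrt k" ?bs] \<open>k > 0\<close>
    by (simp add: k_def abs_mult del: upt_rec_numeral)
  moreover have "sqrt k ^ 9 = sqrt k ^ 7 * sqrt k ^ 2" by (simp flip: power_add)
  ultimately have "sqrt k ^ 9 = 1" using \<open>k > 0\<close> by simp
  then have "sqrt k = 1"
    using \<open>k > 0\<close> by (intro power_eq_imp_eq_base[of "sqrt k" 9 1]) auto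
  then have "k = 1" by simp
  with gk have g2: "g [u, v] = L u \<bullet> L v" for u v by simp
  have "g vs = ?g vs" for vs
  proof (cases "length vs = 2")
    case True
    then obtain u v where "vs = [u, v]" by (auto simp: length_Suc_conv numeral_2_eq_2)
    then show ?thesis by (simp add: g2)
  qed (use multilinear_form_length[OF m] in simp)
  then show "g = ?g" by blast
  have "vol vs = std_volume (map L vs)" for vs
  proof -
    let ?v = "inv L (ax 1)"
    have "L ?v \<bullet> L ?v = 1" by (simp add: surj ax_inner del: One_nat_def)
    then show ?thesis using eq[of ?v ?v vs] unfolding g2 by simp
  qed
  then show "vol = (\<lambda>vs. std_volume (map L vs))" by blast
qed

lemma g2_metric_pullback:
  assumes "linear L" "bij L"
  shows "g2_metric (\<lambda>vs. standard_g2 (map L vs)) =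
    (\<lambda>vs. if length vs = 2 then L (vs ! 0) \<bullet> L (vs ! 1) else 0)"
  unfolding g2_metric_def
  using g2_determines_pullback[OF assms] g2_determines_unique(1)[OF assms]
  by (intro the_equality) blast+

lemma g2_volume_pullback:
  assumes "linear L" "bij L"
  shows "g2_volume (\<lambda>vs. standard_g2 (map L vs)) = (\<lambda>vs. std_volume (map L vs))"
  unfolding g2_volume_def g2_metric_pullback[OF assms]
  using g2_determines_pullback[OF assms] g2_determines_unique(2)[OF assms]
  by (intro the_equality) blast+

section \<open>The dual form\<close>

text \<open>With \<open>M\<close> the matrix of \<open>L\<close> the Gram matrix is
  \<open>M^T M\<close>, so its inverse is \<open>N N^T\<close> for \<open>N = M^-1\<close>: a sum
  over the \<open>g\<close>-orthonormal frame \<open>inv L (axis m 1)\<close>.\<close>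

lemma inv_metric_pullback:
  fixes L :: "real ^ 7 \<Rightarrow> real ^ 7"
  assumes "linear L" "bij L"
  defines "g \<equiv> \<lambda>vs. if length vs = 2 then L (vs ! 0) \<bullet> L (vs ! 1) else 0"
  shows "inv_metric g a b = (\<Sum>m\<in>UNIV. inv L (axis m 1) $ a * inv L (axis m 1) $ b)"
    and "(\<Sum>m\<in>UNIV. component g [c, m] * inv_metric g m b) = (if c = b then 1 else 0)"
proof -
  let ?G = "(\<chi> a b. component g [a, b]) :: real ^ 7 ^ 7"
  let ?M = "matrix L" and ?N = "matrix (inv L)"
  have invL: "linear (inv L)" using assms by (simp add: inj_linear_imp_inv_linear bij_is_inj)
  have "?M ** ?N = matrix (L \<circ> inv L)" "?N ** ?M = matrix (inv L \<circ> L)"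
    using assms invL by (simp_all add: matrix_compose)
  then have MN: "?M ** ?N = mat 1" "?N ** ?M = mat 1"
    using surj_iff[of L] inj_iff[of L] assms(2) by (simp_all add: bij_def matrix_id_mat_1)
  have G: "?G = transpose ?M ** ?M"
    by (simp add: vec_eq_iff g_def component_def matrix_def matrix_matrix_mult_def transpose_def inner_vec_def)
  have "?N ** transpose ?N ** ?G = ?N ** transpose (?M ** ?N) ** ?M"
    unfolding G matrix_transpose_mul matrix_mul_assoc ..
  then have NG: "?N ** transpose ?N ** ?G = mat 1" by (simp add: MN)
  then have "invertible ?G" unfolding invertible_left_inverse by blast
  then have inv: "?G ** matrix_inv ?G = mat 1"
    unfolding invertible_def matrix_inv_def by (rule someI2_ex) simp
  have "?N ** transpose ?N = ?N ** transpose ?N ** (?G ** matrix_inv ?G)" by (simp add: inv)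
  also have "\<dots> = matrix_inv ?G" unfolding matrix_mul_assoc NG by simp
  finally have eq: "matrix_inv ?G = ?N ** transpose ?N" ..
  show "inv_metric g a b = (\<Sum>m\<in>UNIV. inv L (axis m 1) $ a * inv L (axis m 1) $ b)"
    unfolding inv_metric_def eq by (simp add: matrix_def matrix_matrix_mult_def transpose_def)
  have "(?G ** matrix_inv ?G) $ c $ b = (\<Sum>m\<in>UNIV. component g [c, m] * inv_metric g m b)"
    by (simp add: matrix_matrix_mult_def inv_metric_def)
  then show "(\<Sum>m\<in>UNIV. component g [c, m] * inv_metric g m b) = (if c = b then 1 else 0)"
    unfolding inv by (simp add: mat_def)
qed

text \<open>Turns each inverse metric in the Hodge star into a sum over the orthonormal frame
  \<open>inv L (axis m 1)\<close>, on which \<open>L\<close> then cancels.\<close>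

lemma inv_metric_contract:
  fixes L :: "real ^ 7 \<Rightarrow> real ^ 7"
  assumes "linear L" "bij L" "bilinear B"
  shows "(\<Sum>a\<in>UNIV. \<Sum>b\<in>UNIV. inv_metric (\<lambda>vs. if length vs = 2 then L (vs ! 0) \<bullet> L (vs ! 1) else 0) a b
      * B (axis a 1) (axis b 1)) = (\<Sum>m\<in>UNIV. B (inv L (axis m 1)) (inv L (axis m 1)))"
proof -
  have "B v v = (\<Sum>a\<in>UNIV. \<Sum>b\<in>UNIV. v $ a * v $ b * B (axis a 1) (axis b 1))" for v
  proof -
    have "B v v = B (\<Sum>i\<in>UNIV. v $ i *\<^sub>R axis i 1) (\<Sum>i\<in>UNIV. v $ i *\<^sub>R axis i 1)"
      unfolding vec_axis_expansion ..
    also have "\<dots> = (\<Sum>a\<in>UNIV. \<Sum>b\<in>UNIV. v $ a * v $ b * B (axis a 1) (axis b 1))"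
      unfolding bilinear_sum[OF assms(3)] sum.cartesian_product[symmetric]
      by (simp add: bilinear_lmul[OF assms(3)] bilinear_rmul[OF assms(3)] mult_ac)
    finally show ?thesis .
  qed
  then have "(\<Sum>m\<in>UNIV. B (inv L (axis m 1)) (inv L (axis m 1))) =
    (\<Sum>m\<in>UNIV. \<Sum>a\<in>UNIV. \<Sum>b\<in>UNIV. inv L (axis m 1) $ a * inv L (axis m 1) $ b * B (axis a 1) (axis b 1))"
    by simp
  also have "\<dots> = (\<Sum>a\<in>UNIV. \<Sum>m\<in>UNIV. \<Sum>b\<in>UNIV. inv L (axis m 1) $ a * inv L (axis m 1) $ b * B (axis a 1) (axis b 1))"
    by (rule sum.swap)
  also have "\<dots> = (\<Sum>a\<in>UNIV. \<Sum>b\<in>UNIV. \<Sum>m\<in>UNIV. inv L (axis m 1) $ a * inv L (axis m 1) $ b * B (axis a 1) (axis b 1))"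
    by (rule sum.cong[OF refl sum.swap])
  finally show ?thesis
    by (simp add: inv_metric_pullback(1)[OF assms(1,2)] sum_distrib_right)
qed

lemma bilinear_mult:
  "linear f \<Longrightarrow> linear g \<Longrightarrow> bilinear (\<lambda>u v. f u * g v :: real)"
  unfolding bilinear_def by (auto intro!: linearI simp: linear_add linear_scale ring_distribs)

lemma bilinear_sum_pointwise:
  "(\<And>x. x \<in> S \<Longrightarrow> bilinear (f x)) \<Longrightarrow> bilinear (\<lambda>u v. \<Sum>x\<in>S. f x u v)"
  unfolding bilinear_def by (auto intro!: linear_compose_sum)

lemma hodge3_pullback:
  fixes L :: "real ^ 7 \<Rightarrow> real ^ 7"
  assumes "linear L" "bij L" "multilinear_form 3 \<alpha>" "multilinear_form 7 \<beta>" "length vs = 4"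
  shows "hodge3 (\<lambda>vs. if length vs = 2 then L (vs ! 0) \<bullet> L (vs ! 1) else 0)
      (\<lambda>vs. \<beta> (map L vs)) (\<lambda>vs. \<alpha> (map L vs)) vs =
    (\<Sum>m\<in>UNIV. \<Sum>n\<in>UNIV. \<Sum>p\<in>UNIV. \<alpha> [axis m 1, axis n 1, axis p 1]
       * \<beta> (axis m 1 # axis n 1 # axis p 1 # map L vs)) / 6"
proof -
  let ?g = "\<lambda>vs. if length vs = 2 then L (vs ! 0) \<bullet> L (vs ! 1) else 0"
  let ?G = "inv_metric ?g"
  let ?e = "\<lambda>i. axis i 1 :: real ^ 7"
  let ?N = "\<lambda>m. inv L (?e m)"
  let ?\<alpha> = "\<lambda>u v w. \<alpha> [L u, L v, L w]" and ?\<beta> = "\<lambda>u v w. \<beta> (L u # L v # L w # map L vs)"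
  have \<alpha>: "linear (\<lambda>u. ?\<alpha> u v w)" "linear (\<lambda>u. ?\<alpha> v u w)" "linear (\<lambda>u. ?\<alpha> v w u)" for v w
    using linear_3_slots[OF assms(3)] by (auto intro: linear_compose[OF assms(1), unfolded o_def])
  have \<beta>: "linear (\<lambda>u. ?\<beta> u v w)" "linear (\<lambda>u. ?\<beta> v u w)" "linear (\<lambda>u. ?\<beta> v w u)" for v w
    using multilinear_form_linear[OF assms(4), of "[]" "L v # L w # map L vs"]
      multilinear_form_linear[OF assms(4), of "[L v]" "L w # map L vs"]
      multilinear_form_linear[OF assms(4), of "[L v, L w]" "map L vs"] assms(5)
    by (auto intro: linear_compose[OF assms(1), unfolded o_def])
  have LN: "L (?N m) = ?e m" for m
    using assms(2) by (simp add: bij_is_surj surj_f_inv_f)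
  have swap: "(\<Sum>b\<in>UNIV. \<Sum>c\<in>UNIV. \<Sum>i\<in>UNIV. f b c i) = (\<Sum>i\<in>UNIV. \<Sum>b\<in>UNIV. \<Sum>c\<in>UNIV. f b c i)"
    for f :: "7 \<Rightarrow> 7 \<Rightarrow> 7 \<Rightarrow> real"
    by (subst (2) sum.swap, subst sum.swap) (rule refl)
  have "hodge3 ?g (\<lambda>vs. \<beta> (map L vs)) (\<lambda>vs. \<alpha> (map L vs)) vs * 6 =
      (\<Sum>a\<in>UNIV. \<Sum>b\<in>UNIV. \<Sum>c\<in>UNIV. \<Sum>i\<in>UNIV. \<Sum>j\<in>UNIV. \<Sum>k\<in>UNIV.
        ?G a i * ?G b j * ?G c k * ?\<alpha> (?e a) (?e b) (?e c) * ?\<beta> (?e i) (?e j) (?e k))"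
    by (simp add: hodge3_def component_def fact_numeral)
  \<comment> \<open>Interleave the sums so that the two indices of each inverse metric are adjacent;
    the pairs are then contracted from the innermost outwards.\<close>
  also have "\<dots> = (\<Sum>a\<in>UNIV. \<Sum>i\<in>UNIV. \<Sum>b\<in>UNIV. \<Sum>j\<in>UNIV. \<Sum>c\<in>UNIV. \<Sum>k\<in>UNIV.
        ?G a i * ?G b j * ?G c k * ?\<alpha> (?e a) (?e b) (?e c) * ?\<beta> (?e i) (?e j) (?e k))"
    by (rule trans[OF sum.cong[OF refl swap]],
        rule sum.cong[OF refl], rule sum.cong[OF refl], rule sum.cong[OF refl], rule sum.swap)
  also have "\<dots> = (\<Sum>a\<in>UNIV. \<Sum>i\<in>UNIV. ?G a i * (\<Sum>b\<in>UNIV. \<Sum>j\<in>UNIV. ?G b j * (\<Sum>c\<in>UNIV. \<Sum>k\<in>UNIV.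
        ?G c k * (?\<alpha> (?e a) (?e b) (?e c) * ?\<beta> (?e i) (?e j) (?e k)))))"
    by (simp add: sum_distrib_left mult_ac)
  also have "\<dots> = (\<Sum>a\<in>UNIV. \<Sum>i\<in>UNIV. ?G a i * (\<Sum>b\<in>UNIV. \<Sum>j\<in>UNIV. ?G b j * (\<Sum>p\<in>UNIV.
        ?\<alpha> (?e a) (?e b) (?N p) * ?\<beta> (?e i) (?e j) (?N p))))"
    by (subst inv_metric_contract[OF assms(1,2) bilinear_mult[OF \<alpha>(3) \<beta>(3)]]) (rule refl)
  also have "\<dots> = (\<Sum>a\<in>UNIV. \<Sum>i\<in>UNIV. ?G a i * (\<Sum>n\<in>UNIV. \<Sum>p\<in>UNIV.
        ?\<alpha> (?e a) (?N n) (?N p) * ?\<beta> (?e i) (?N n) (?N p)))"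
    by (subst inv_metric_contract[OF assms(1,2) bilinear_sum_pointwise[OF bilinear_mult[OF \<alpha>(2) \<beta>(2)]]]) (rule refl)
  also have "\<dots> = (\<Sum>m\<in>UNIV. \<Sum>n\<in>UNIV. \<Sum>p\<in>UNIV.
        ?\<alpha> (?N m) (?N n) (?N p) * ?\<beta> (?N m) (?N n) (?N p))"
    by (subst inv_metric_contract[OF assms(1,2) bilinear_sum_pointwise[OF bilinear_sum_pointwise[OF bilinear_mult[OF \<alpha>(1) \<beta>(1)]]]]) (rule refl)
  finally show ?thesis by (simp add: LN)
qed

text \<open>For an orthonormal frame the dual of the wedge of \<open>e^a\<close>,
  \<open>e^b\<close>, \<open>e^c\<close> is the volume form with \<open>e_a\<close>,
  \<open>e_b\<close>, \<open>e_c\<close> in its first three slots; this is extended linearly over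
  the seven terms.\<close>

definition std_dual :: tensor where
  "std_dual vs = (\<Sum>(s, a, b, c)\<leftarrow>g2_lines. of_int s * std_volume (ax a # ax b # ax c # vs))"

text \<open>\<open>e3_coeff a b c\<close> is a signed sum of six products of Kronecker deltas, one
  for each ordering of the triple, and each product selects one value of \<open>F\<close>.\<close>

lemma sum_e3_coeff:
  fixes F :: "nat \<Rightarrow> nat \<Rightarrow> nat \<Rightarrow> real"
  assumes "distinct [a, b, c]" "{a, b, c} \<subseteq> {1..7}"
  shows "(\<Sum>m=1..7. \<Sum>n=1..7. \<Sum>p=1..7. of_int (e3_coeff a b c m n p) * F m n p) =
    F a b c - F a c b + F b c a - F b a c + F c a b - F c b a"
proof -
  let ?S = "{1..7} :: nat set"
  have e3: "of_int (e3_coeff a b c m n p) * F m n p =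
    (if m = a then if n = b then if p = c then F m n p else 0 else 0 else 0) -
    (if m = a then if n = c then if p = b then F m n p else 0 else 0 else 0) +
    (if m = b then if n = c then if p = a then F m n p else 0 else 0 else 0) -
    (if m = b then if n = a then if p = c then F m n p else 0 else 0 else 0) +
    (if m = c then if n = a then if p = b then F m n p else 0 else 0 else 0) -
    (if m = c then if n = b then if p = a then F m n p else 0 else 0 else 0)" for m n p
    using assms(1) by (simp add: e3_coeff_def)
  have delta: "(\<Sum>m\<in>?S. \<Sum>n\<in>?S. \<Sum>p\<in>?S. if m = x then if n = y then if p = z then F m n p else 0 else 0 else 0) = F x y z"
    if "x \<in> ?S" "y \<in> ?S" "z \<in> ?S" for x y z
  proof -
    have 1: "(\<Sum>p\<in>?S. if n = y then if p = z then F m n p else 0 else 0) = (if n = y then F m n z else 0)" for m n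
      using that by (cases "n = y") auto
    have "(\<Sum>n\<in>?S. \<Sum>p\<in>?S. if m = x then if n = y then if p = z then F m n p else 0 else 0 else 0) =
        (if m = x then F m y z else 0)" for m
      using that by (cases "m = x") (simp_all add: 1 del: One_nat_def)
    then show ?thesis using that by simp
  qed
  show ?thesis
    unfolding e3 sum.distrib sum_subtractf using assms(2) by (simp only: delta insert_subset)
qed

text \<open>The six orderings of each triple contribute equally, because the coefficient and the
  volume form change sign together; this cancels the 3! of the Hodge star.\<close>

lemma hodge3_standard:
  "(\<Sum>m\<in>UNIV. \<Sum>n\<in>UNIV. \<Sum>p\<in>UNIV. standard_g2 [axis m 1, axis n 1, axis p 1]
     * std_volume (axis m 1 # axis n 1 # axis p 1 # vs)) / 6 = std_dual vs"
proof -
  let ?F = "\<lambda>m n p. std_volume (ax m # ax n # ax p # vs)"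
  have "(\<Sum>m\<in>UNIV. \<Sum>n\<in>UNIV. \<Sum>p\<in>UNIV. standard_g2 [axis m 1, axis n 1, axis p 1]
     * std_volume (axis m 1 # axis n 1 # axis p 1 # vs)) =
     (\<Sum>m=1..7. \<Sum>n=1..7. \<Sum>p=1..7. standard_g2 [ax m, ax n, ax p] * ?F m n p)"
    by (simp add: sum_UNIV_7 ax_def)
  also have "\<dots> = (\<Sum>m=1..7. \<Sum>n=1..7. \<Sum>p=1..7. of_int (g2_coeff m n p) * ?F m n p)"
    by (intro sum.cong refl) (simp add: standard_g2_ax del: One_nat_def)
  also have "\<dots> = (\<Sum>(s, a, b, c)\<leftarrow>g2_lines. of_int s * (\<Sum>m=1..7. \<Sum>n=1..7. \<Sum>p=1..7. of_int (e3_coeff a b c m n p) * ?F m n p))"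
    by (simp add: g2_coeff_def g2_lines_def sum.distrib sum_distrib_left ring_distribs sum_negf sum_subtractf del: One_nat_def)
  also have "\<dots> = (\<Sum>(s, a, b, c)\<leftarrow>g2_lines. of_int s * (6 * ?F a b c))"
  proof -
    have "(\<Sum>m=1..7. \<Sum>n=1..7. \<Sum>p=1..7. of_int (e3_coeff a b c m n p) * ?F m n p) = 6 * ?F a b c"
      if "(s, a, b, c) \<in> set g2_lines" for s a b c
    proof -
      have abc: "distinct [a, b, c]" "{a, b, c} \<subseteq> {1..7}" using that by (auto simp: g2_lines_def)
      have s12: "?F m n p = - ?F n m p" and s23: "?F m n p = - ?F m p n" for m n p
        using alternating_form_swap[OF alternating_form_std_volume, of "[]" "ax m" "[]" "ax n" "ax p # vs"]
          alternating_form_swap[OF alternating_form_std_volume, of "[ax m]" "ax n" "[]" "ax p" "vs"] by simp_all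
      have "?F a c b = - ?F a b c" "?F b a c = - ?F a b c" "?F b c a = ?F a b c" "?F c a b = ?F a b c" "?F c b a = - ?F a b c"
        using s12[of b a c] s23[of a b c] s23[of b c a] s12[of c a b] s23[of c b a] by simp_all
      then show ?thesis unfolding sum_e3_coeff[OF abc] by simp
    qed
    then show ?thesis
      by (intro arg_cong[where f = sum_list] map_cong) auto
  qed
  also have "\<dots> = 6 * std_dual vs"
    by (simp add: std_dual_def g2_lines_def)
  finally show ?thesis by simp
qed

lemma g2_dual_pullback:
  assumes "linear L" "bij L" "length vs = 4"
  shows "g2_dual (\<lambda>vs. standard_g2 (map L vs)) vs = std_dual (map L vs)"
  unfolding g2_dual_def g2_metric_pullback[OF assms(1,2)] g2_volume_pullback[OF assms(1,2)]
  by (subst hodge3_pullback[OF assms(1,2) alternating_form_multilinear[OF alternating_form_standard_g2]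
        alternating_form_multilinear[OF alternating_form_std_volume] assms(3)])
    (rule hodge3_standard)

section \<open>Interior products and the derivation action of endomorphisms on 3-forms\<close>

lemma alternating_form_interior_prod:
  assumes "alternating_form (Suc k) \<alpha>"
  shows "alternating_form k (interior_prod u \<alpha>)"
  using assms multilinear_form_interior_prod[of k \<alpha> u]
  by (auto simp: alternating_form_def interior_prod_def)

text \<open>The derivation induced by \<open>A\<close>: for a 3-form, the linear term in
  \<open>s\<close> of its pullback by \<open>id + s A\<close>.\<close>

definition form_action :: "(real ^ 7 \<Rightarrow> real ^ 7) \<Rightarrow> tensor \<Rightarrow> tensor" where
  "form_action A \<alpha> vs = (if length vs = 3
     then \<alpha> [A (vs ! 0), vs ! 1, vs ! 2] + \<alpha> [vs ! 0, A (vs ! 1), vs ! 2] + \<alpha> [vs ! 0, vs ! 1, A (vs ! 2)]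
     else 0)"

lemma form_action_apply:
  "form_action A \<alpha> [u, v, w] = \<alpha> [A u, v, w] + \<alpha> [u, A v, w] + \<alpha> [u, v, A w]"
  by (simp add: form_action_def numeral_2_eq_2)

text \<open>With two equal entries, one of the three terms has a repeated entry and the other two
  differ by an exchange, so they cancel.\<close>

lemma alternating_form_form_action:
  assumes "alternating_form 3 \<alpha>" "linear A"
  shows "alternating_form 3 (form_action A \<alpha>)"
  unfolding alternating_form_def
proof (intro conjI allI impI)
  note l = linear_3_slots[OF alternating_form_multilinear[OF assms(1)]]
  show "multilinear_form 3 (form_action A \<alpha>)"
  proof (rule multilinear_formI)
    fix xs ys :: "(real ^ 7) list" assume "length xs + length ys + 1 = 3"
    then consider v w where "xs = []" "ys = [v, w]" | v w where "xs = [v]" "ys = [w]"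
      | v w where "xs = [v, w]" "ys = []"
    proof -
      have "length xs = 0 \<and> length ys = 2 \<or> length xs = 1 \<and> length ys = 1 \<or> length xs = 2 \<and> length ys = 0"
        using \<open>length xs + length ys + 1 = 3\<close> by arith
      then show thesis using that by (auto simp: length_Suc_conv numeral_2_eq_2)
    qed
    then show "linear (\<lambda>v. form_action A \<alpha> (xs @ v # ys))"
      by cases (auto simp: form_action_apply
          intro!: linear_compose_add l linear_compose[OF assms(2) l(1), unfolded o_def]
            linear_compose[OF assms(2) l(2), unfolded o_def] linear_compose[OF assms(2) l(3), unfolded o_def])
  qed (simp add: form_action_def)
  fix vs :: "(real ^ 7) list" assume nd: "\<not> distinct vs"
  show "form_action A \<alpha> vs = 0"
  proof (cases "length vs = 3")
    case True
    then obtain u v w where vs: "vs = [u, v, w]" by (auto simp: eval_nat_numeral length_Suc_conv)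
    have s12: "\<alpha> [x, y, z] = - \<alpha> [y, x, z]" and s23: "\<alpha> [x, y, z] = - \<alpha> [x, z, y]"
      and s13: "\<alpha> [x, y, z] = - \<alpha> [z, y, x]" for x y z
      using alternating_form_swap[OF assms(1), of "[]" x "[]" y "[z]"]
        alternating_form_swap[OF assms(1), of "[x]" y "[]" z "[]"]
        alternating_form_swap[OF assms(1), of "[]" x "[y]" z "[]"] by simp_all
    consider "u = v" | "v = w" | "u = w" using nd vs by auto
    then show ?thesis
    proof cases
      case 1
      then show ?thesis
        using s12[of "A u" u w] s12[of u u "A w"] by (simp add: vs form_action_apply)
    next
      case 2
      then show ?thesis
        using s23[of u "A v" v] s23[of "A u" v v] by (simp add: vs form_action_apply)
    next
      case 3
      then show ?thesis
        using s13[of "A u" v u] s13[of u "A v" u] by (simp add: vs form_action_apply)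
    qed
  qed (simp add: form_action_def)
qed

lemma alternating_form_std_dual: "alternating_form 4 std_dual"
proof -
  have "alternating_form 4 (interior_prod (ax c) (interior_prod (ax b) (interior_prod (ax a) std_volume)))" for a b c
    using alternating_form_std_volume
    by (intro alternating_form_interior_prod) (simp add: eval_nat_numeral)
  then have "alternating_form 4 (\<lambda>vs. \<Sum>x\<leftarrow>g2_lines. (case x of (s, a, b, c) \<Rightarrow>
      \<lambda>vs. of_int s * interior_prod (ax c) (interior_prod (ax b) (interior_prod (ax a) std_volume)) vs) vs)"
    by (intro alternating_form_sum_list) (auto intro: alternating_form_scale)
  then show ?thesis
    by (simp add: std_dual_def[abs_def] interior_prod_def case_prod_unfold)
qed

section \<open>The contraction identity for the dual form, in integer coefficients\<close>

definition std_dual_coeff :: "nat \<Rightarrow> nat \<Rightarrow> nat \<Rightarrow> nat \<Rightarrow> int" where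
  "std_dual_coeff l i j k = (\<Sum>(s, a, b, c)\<leftarrow>g2_lines.
     s * (if distinct [a, b, c, l, i, j, k] then - arrange_sign [1..<8] [a, b, c, l, i, j, k] else 0))"

lemma std_dual_ax:
  assumes "{l, i, j, k} \<subseteq> {1..7}"
  shows "std_dual [ax l, ax i, ax j, ax k] = of_int (std_dual_coeff l i j k)"
proof -
  have "std_volume [ax a, ax b, ax c, ax l, ax i, ax j, ax k] =
      of_int (if distinct [a, b, c, l, i, j, k] then - arrange_sign [1..<8] [a, b, c, l, i, j, k] else 0)"
    if "(s, a, b, c) \<in> set g2_lines" for s a b c
  proof -
    have "set [a, b, c, l, i, j, k] \<subseteq> {1..7}"
      using that assms by (auto simp: g2_lines_def)
    from std_volume_map_ax[OF _ this] show ?thesis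
      by (simp only: list.map list.size)
  qed
  then show ?thesis
    unfolding std_dual_def std_dual_coeff_def sum_list_of_int[symmetric]
    by (intro arg_cong[where f = sum_list] map_cong) auto
qed

text \<open>The contraction of \<open>\<phi>(l,i,m) \<phi>(m,j,k)\<close> over \<open>m\<close>; the
  test for 0 saves the evaluation of the second factor.\<close>

definition contracted_coeff :: "nat \<Rightarrow> nat \<Rightarrow> nat \<Rightarrow> nat \<Rightarrow> int" where
  "contracted_coeff l i j k = (\<Sum>m\<leftarrow>[1..<8]. let a = g2_coeff l i m in if a = 0 then 0 else a * g2_coeff m j k)"

definition std_dual_coeff_correct :: "nat \<times> nat list \<Rightarrow> bool" where
  "std_dual_coeff_correct = (\<lambda>(l, js). case js of [i, j, k] \<Rightarrow> 3 * std_dual_coeff l i j k =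
     - (contracted_coeff l i j k - contracted_coeff l j i k + contracted_coeff l k i j) | _ \<Rightarrow> True)"

text \<open>Behind the check is the classical identity, summed over \<open>m\<close>,
  \<open>\<phi>(l,i,m) \<phi>(m,j,k) = g(l,j) g(i,k) - g(l,k) g(i,j) - \<psi>(l,i,j,k)\<close>. In
  the signed sum over the three choices of the index beside \<open>l\<close> the metric terms cancel
  and \<psi> occurs three times.\<close>

lemma std_dual_coeff_correct:
  "list_all std_dual_coeff_correct (List.product [1..<8] (subseqs [1..<8]))"
  by code_simp

text \<open>The factor -1/3 offsets the coefficient -3 with which \<psi> occurs in the signed sum of
  the three contractions of \<phi> with itself.\<close>

definition g2_endo :: "real ^ 7 \<Rightarrow> real ^ 7 \<Rightarrow> real ^ 7" where
  "g2_endo Y u = (- 1 / 3) *\<^sub>R (\<Sum>m=1..7. standard_g2 [Y, u, ax m] *\<^sub>R ax m)"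

lemmas standard_g2_linear = linear_3_slots[OF alternating_form_multilinear[OF alternating_form_standard_g2]]

lemma standard_g2_swap:
  "standard_g2 [v, u, w] = - standard_g2 [u, v, w]" "standard_g2 [u, w, v] = - standard_g2 [u, v, w]"
  using alternating_form_swap[OF alternating_form_standard_g2, of "[]" v "[]" u "[w]"]
    alternating_form_swap[OF alternating_form_standard_g2, of "[u]" w "[]" v "[]"] by simp_all

lemma linear_g2_endo: "linear (g2_endo Y)" "linear (\<lambda>Y. g2_endo Y u)"
  unfolding g2_endo_def
  by (intro linearI; simp add: linear_add[OF standard_g2_linear(2)] linear_scale[OF standard_g2_linear(2)]
      linear_add[OF standard_g2_linear(1)] linear_scale[OF standard_g2_linear(1)]
      scaleR_add_left scaleR_add_right sum.distrib scaleR_sum_right mult_ac)+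

lemma inner_g2_endo: "g2_endo Y u \<bullet> v = - standard_g2 [Y, u, v] / 3"
proof -
  have ax: "ax m \<bullet> v = v $ of_nat m" for m
    by (simp add: ax_def inner_axis')
  have "standard_g2 [Y, u, v] = standard_g2 [Y, u, \<Sum>m=1..7. v $ of_nat m *\<^sub>R ax m]"
    using vec_7_expansion[of v] by simp
  also have "\<dots> = (\<Sum>m=1..7. standard_g2 [Y, u, ax m] * (ax m \<bullet> v))"
    by (simp add: linear_sum[OF standard_g2_linear(3)] linear_scale[OF standard_g2_linear(3)] ax mult.commute)
  also have "\<dots> = -3 * (g2_endo Y u \<bullet> v)"
    by (simp add: g2_endo_def inner_sum_left)
  finally show ?thesis by simp
qed

lemma inner_g2_endo_skew: "g2_endo Y u \<bullet> v = - (u \<bullet> g2_endo Y v)"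
  using standard_g2_swap(2)[of Y u v] by (simp add: inner_g2_endo inner_commute[of u])

text \<open>Both sides are linear in \<open>Y\<close> and alternating in the other arguments, which
  leaves one integer identity for each of 7 indices and 35 increasing triples.\<close>

lemma interior_prod_std_dual: "interior_prod Y std_dual = form_action (g2_endo Y) standard_g2"
proof (rule alternating_form_eqI)
  show "alternating_form 3 (interior_prod Y std_dual)"
    using alternating_form_std_dual by (intro alternating_form_interior_prod) (simp add: eval_nat_numeral)
  show "alternating_form 3 (form_action (g2_endo Y) standard_g2)"
    by (intro alternating_form_form_action alternating_form_standard_g2 linear_g2_endo)
  fix js :: "nat list" assume js: "length js = 3" "js \<in> set (subseqs [1..<8])"
  then obtain i j k where ijk: "js = [i, j, k]" by (auto simp: eval_nat_numeral length_Suc_conv)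
  have "set js \<subseteq> {1..7}"
  proof -
    have "set js \<in> set ` set (subseqs [1..<8])" using js(2) by blast
    then show ?thesis unfolding subseqs_powset by auto
  qed
  then have range: "{i, j, k} \<subseteq> {1..7}" by (simp add: ijk)
  have contract: "standard_g2 [g2_endo (ax l) (ax x), ax y, ax z] = - of_int (contracted_coeff l x y z) / 3"
    if "{l, x, y, z} \<subseteq> {1..7}" for l x y z
  proof -
    have "standard_g2 [g2_endo (ax l) (ax x), ax y, ax z] =
       - (\<Sum>m=1..7. standard_g2 [ax l, ax x, ax m] * standard_g2 [ax m, ax y, ax z]) / 3"
      by (simp add: g2_endo_def linear_neg[OF standard_g2_linear(1)] linear_scale[OF standard_g2_linear(1)] linear_sum[OF standard_g2_linear(1)])
    also have "(\<Sum>m=1..7. standard_g2 [ax l, ax x, ax m] * standard_g2 [ax m, ax y, ax z]) =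
        (\<Sum>m=1..7. of_int (g2_coeff l x m * g2_coeff m y z))"
      using that by (intro sum.cong refl) (simp add: standard_g2_ax del: One_nat_def)
    also have "\<dots> = of_int (contracted_coeff l x y z)"
    proof -
      have "contracted_coeff l x y z = (\<Sum>m\<leftarrow>[1..<8]. g2_coeff l x m * g2_coeff m y z)"
        unfolding contracted_coeff_def by (intro arg_cong[where f = sum_list] map_cong) (auto simp: Let_def)
      also have "\<dots> = (\<Sum>m=1..7. g2_coeff l x m * g2_coeff m y z)"
        unfolding interv_sum_list_conv_sum_set_nat by (intro sum.cong) auto
      finally show ?thesis by simp
    qed
    finally show ?thesis .
  qed
  show "interior_prod Y std_dual (map ax js) = form_action (g2_endo Y) standard_g2 (map ax js)"
  proof (rule linear_eqI_ax[where f = "\<lambda>Y. interior_prod Y std_dual (map ax js)"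
        and g = "\<lambda>Y. form_action (g2_endo Y) standard_g2 (map ax js)"])
    show "linear (\<lambda>Y. interior_prod Y std_dual (map ax js))"
      using multilinear_form_linear[OF alternating_form_multilinear[OF alternating_form_std_dual], of "[]" "map ax js"]
      by (simp add: interior_prod_def js)
    show "linear (\<lambda>Y. form_action (g2_endo Y) standard_g2 (map ax js))"
      unfolding ijk list.map form_action_apply
      by (intro linear_compose_add linear_compose[OF linear_g2_endo(2) standard_g2_linear(1), unfolded o_def]
          linear_compose[OF linear_g2_endo(2) standard_g2_linear(2), unfolded o_def]
          linear_compose[OF linear_g2_endo(2) standard_g2_linear(3), unfolded o_def])
    fix l :: nat assume l: "l \<in> {1..7}"
    have "(l, js) \<in> set (List.product [1..<8] (subseqs [1..<8]))"
      using js(2) l by (auto simp del: upt_rec_numeral in_set_subseqs)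
    then have "std_dual_coeff_correct (l, js)"
      using std_dual_coeff_correct by (simp only: list_all_iff)
    then have "3 * std_dual_coeff l i j k =
        - (contracted_coeff l i j k - contracted_coeff l j i k + contracted_coeff l k i j)"
      by (simp add: std_dual_coeff_correct_def ijk)
    from arg_cong[OF this, of "of_int :: int \<Rightarrow> real"]
    have "3 * std_dual [ax l, ax i, ax j, ax k] =
        - of_int (contracted_coeff l i j k - contracted_coeff l j i k + contracted_coeff l k i j)"
      using range l by (simp add: std_dual_ax del: One_nat_def)
    \<comment> \<open>Moving the transformed argument to the first slot produces the signs +, -, +
      of the integer identity.\<close>
    moreover have "form_action (g2_endo (ax l)) standard_g2 [ax i, ax j, ax k] =
        standard_g2 [g2_endo (ax l) (ax i), ax j, ax k] - standard_g2 [g2_endo (ax l) (ax j), ax i, ax k]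
        + standard_g2 [g2_endo (ax l) (ax k), ax i, ax j]"
      using standard_g2_swap(1)[of "ax i" "g2_endo (ax l) (ax j)" "ax k"]
        standard_g2_swap(2)[of "ax i" "g2_endo (ax l) (ax k)" "ax j"]
        standard_g2_swap(1)[of "g2_endo (ax l) (ax k)" "ax i" "ax j"]
      by (simp add: form_action_apply)
    ultimately show "interior_prod (ax l) std_dual (map ax js) = form_action (g2_endo (ax l)) standard_g2 (map ax js)"
      using range l by (simp add: contract ijk interior_prod_def del: One_nat_def)
  qed
qed

section \<open>Variation of the metric\<close>

text \<open>Encodes a form, a function on lists, as a point of a Euclidean space, where the metric
  has a Frechet derivative as a function of the form.\<close>

definition coords :: "tensor \<Rightarrow> real ^ (7 \<times> 7 \<times> 7)" where
  "coords \<alpha> = (\<chi> x. component \<alpha> [fst x, fst (snd x), snd (snd x)])"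

definition gram_poly :: "7 \<Rightarrow> 7 \<Rightarrow> real ^ (7 \<times> 7 \<times> 7) \<Rightarrow> real" where
  "gram_poly i j x = (\<Sum>\<sigma> | \<sigma> permutes {..<7 :: nat}. of_int (sign \<sigma>) *
    (x $ (i, of_nat (Suc (\<sigma> 0)), of_nat (Suc (\<sigma> 1))) * x $ (j, of_nat (Suc (\<sigma> 2)), of_nat (Suc (\<sigma> 3)))
     * x $ (of_nat (Suc (\<sigma> 4)), of_nat (Suc (\<sigma> 5)), of_nat (Suc (\<sigma> 6))))) / 24"

text \<open>With \<open>V\<close> the volume of the coordinate frame, \<open>B = -6 V g\<close> and
  \<open>det g = V^2\<close>, which gives the exponent 9 = 7 + 2. As it is odd, the real root also
  recovers the sign of \<open>V\<close>, which depends on the orientation of the frame.\<close>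

definition metric_coord :: "7 \<Rightarrow> 7 \<Rightarrow> real ^ (7 \<times> 7 \<times> 7) \<Rightarrow> real" where
  "metric_coord i j x = gram_poly i j x / (- 6 * root 9 (det (\<chi> a b. gram_poly a b x) / (- 6) ^ 7))"

lemma gram_poly_coords: "gram_poly i j (coords \<phi>) = g2_gram \<phi> (axis i 1) (axis j 1) (map ax [1..<8])"
proof -
  let ?vs = "map ax [1..<8]"
  have nth: "?vs ! \<sigma> k = axis (of_nat (Suc (\<sigma> k))) 1" if "\<sigma> permutes {..<7}" "k < 7" for \<sigma> k
    using permutes_lessThan_less[OF that] by (auto simp: ax_def simp del: upt_rec_numeral)
  have "g2_gram \<phi> (axis i 1) (axis j 1) ?vs = (\<Sum>\<sigma> | \<sigma> permutes {..<7}. of_int (sign \<sigma>) *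
    (\<phi> [axis i 1, ?vs ! \<sigma> 0, ?vs ! \<sigma> 1] * \<phi> [axis j 1, ?vs ! \<sigma> 2, ?vs ! \<sigma> 3] * \<phi> [?vs ! \<sigma> 4, ?vs ! \<sigma> 5, ?vs ! \<sigma> 6])) / 24"
    by (rule g2_gram_apply) (simp del: upt_rec_numeral)
  also have "\<dots> = gram_poly i j (coords \<phi>)"
    unfolding gram_poly_def
    by (intro arg_cong[where f = "\<lambda>x. x / 24"] sum.cong refl)
      (simp add: nth coords_def component_def del: upt_rec_numeral One_nat_def of_nat_Suc)
  finally show ?thesis ..
qed

lemma metric_coord_coords:
  assumes "linear L" "bij L"
  defines "\<phi> \<equiv> \<lambda>vs. standard_g2 (map L vs)"
  shows "metric_coord i j (coords \<phi>) = L (axis i 1) \<bullet> L (axis j 1)"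
    and "det (\<chi> a b. gram_poly a b (coords \<phi>)) \<noteq> 0"
proof -
  let ?M = "matrix L"
  let ?V = "std_volume (map L (map ax [1..<8]))"
  have "map L (map ax [1..<8]) ! (index_7 a - 1) = L (axis a 1)" for a
  proof -
    have "map L (map ax [1..<8]) ! (index_7 a - 1) = L (ax (index_7 a))"
      using index_7(1)[of a] by (auto simp del: upt_rec_numeral)
    then show ?thesis by (simp add: ax_def index_7)
  qed
  then have V: "?V = - det (transpose ?M)"
    by (simp add: std_volume_def transpose_def matrix_def del: upt_rec_numeral One_nat_def)
  have "matrix (inv L) ** ?M = mat 1"
    using assms(1,2) matrix_compose[of L "inv L"] inj_iff[of L]
    by (simp add: inj_linear_imp_inv_linear bij_is_inj matrix_id_mat_1)
  then have "det (matrix (inv L)) * det ?M = 1" by (metis det_mul det_I)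
  then have V0: "?V \<noteq> 0" unfolding V by (auto simp: det_transpose)
  have "(\<chi> a b. L (axis a 1) \<bullet> L (axis b 1)) = transpose ?M ** ?M"
    by (simp add: vec_eq_iff matrix_def matrix_matrix_mult_def transpose_def inner_vec_def)
  then have G: "det (\<chi> a b. L (axis a 1) \<bullet> L (axis b 1)) = ?V ^ 2"
    by (simp only: det_mul V det_transpose power2_eq_square minus_mult_minus)
  have gram: "gram_poly a b (coords \<phi>) = - 6 * ?V * (L (axis a 1) \<bullet> L (axis b 1))" for a b
    unfolding gram_poly_coords \<phi>_def g2_gram_pullback g2_gram_standard by simp
  have "det (\<chi> a b. gram_poly a b (coords \<phi>)) =
      det (\<chi> a. (- 6 * ?V) *s (\<chi> b. L (axis a 1) \<bullet> L (axis b 1)))"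
    unfolding gram by (simp add: vector_scalar_mult_def)
  also have "\<dots> = (- 6 * ?V) ^ 7 * ?V ^ 2"
    unfolding det_rows_mul G by simp
  also have "\<dots> = (- 6) ^ 7 * ?V ^ 9"
    by (simp only: power_mult_distrib mult.assoc power_add[symmetric]) simp
  finally have det: "det (\<chi> a b. gram_poly a b (coords \<phi>)) = (- 6) ^ 7 * ?V ^ 9" .
  then show "det (\<chi> a b. gram_poly a b (coords \<phi>)) \<noteq> 0" using V0 by simp
  have "root 9 (det (\<chi> a b. gram_poly a b (coords \<phi>)) / (- 6) ^ 7) = ?V"
    unfolding det by (simp add: odd_real_root_power_cancel)
  then show "metric_coord i j (coords \<phi>) = L (axis i 1) \<bullet> L (axis j 1)"
    unfolding metric_coord_def gram using V0 by simp
qed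

lemma differentiable_gram_poly: "gram_poly i j differentiable (at x)"
proof -
  have "(\<lambda>x :: real ^ (7 \<times> 7 \<times> 7). x $ k) differentiable (at x)" for k
    by (intro bounded_linear_imp_differentiable bounded_linear_vec_nth)
  then show ?thesis
    unfolding gram_poly_def[abs_def]
    by (intro differentiable_divide differentiable_sum differentiable_mult differentiable_const)
      (auto simp: finite_permutations)
qed

text \<open>A nonzero determinant keeps the ninth root away from 0, where it is not differentiable,
  and keeps the denominator from vanishing.\<close>

lemma differentiable_metric_coord:
  assumes "det (\<chi> a b. gram_poly a b x) \<noteq> 0"
  shows "metric_coord i j differentiable (at x)"
proof -
  have "(\<lambda>x. \<Prod>i\<in>UNIV. gram_poly i (p i) x) differentiable (at x)" for p :: "7 \<Rightarrow> 7"
  proof -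
    have "\<exists>D. (gram_poly i (p i) has_derivative D) (at x)" for i
      using differentiable_gram_poly by (simp add: differentiable_def)
    then obtain D where D: "\<And>i. (gram_poly i (p i) has_derivative D i) (at x)" by metis
    show ?thesis
      unfolding differentiable_def by (rule exI, rule has_derivative_prod, rule D)
  qed
  then have d: "(\<lambda>x. det (\<chi> a b. gram_poly a b x) / (- 6) ^ 7) differentiable (at x)"
    unfolding det_def vec_lambda_beta
    by (intro differentiable_divide differentiable_sum differentiable_mult differentiable_const) auto
  have "root 9 differentiable (at (det (\<chi> a b. gram_poly a b x) / (- 6) ^ 7))"
  proof -
    have "(root 9 has_real_derivative inverse (real 9 * root 9 (det (\<chi> a b. gram_poly a b x) / (- 6) ^ 7) ^ (9 - Suc 0)))
        (at (det (\<chi> a b. gram_poly a b x) / (- 6) ^ 7))"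
      by (rule DERIV_real_root_generic) (use assms in auto)
    then show ?thesis by (meson differentiable_def has_field_derivative_def)
  qed
  from differentiable_chain_at[OF d this]
  have "(\<lambda>x. root 9 (det (\<chi> a b. gram_poly a b x) / (- 6) ^ 7)) differentiable (at x)"
    by (simp add: o_def)
  then show ?thesis
    unfolding metric_coord_def[abs_def]
    by (intro differentiable_divide differentiable_mult differentiable_const differentiable_gram_poly)
      (use assms in \<open>auto simp: real_root_eq_0_iff\<close>)
qed

section \<open>Derivatives along curves and the comparison path\<close>

lemma has_vector_derivative_vec:
  fixes f :: "real \<Rightarrow> real ^ 'n"
  assumes "\<And>i. ((\<lambda>s. f s $ i) has_real_derivative d $ i) (at t within S)"
  shows "(f has_vector_derivative d) (at t within S)"
proof -
  have "((\<lambda>s. \<Sum>i\<in>UNIV. f s $ i *\<^sub>R (axis i 1 :: real ^ 'n)) has_vector_derivative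
      (\<Sum>i\<in>UNIV. d $ i *\<^sub>R axis i 1)) (at t within S)"
    using assms unfolding has_real_derivative_iff_has_vector_derivative
    by (intro has_vector_derivative_sum bounded_linear.has_vector_derivative[OF bounded_linear_scaleR_left]) auto
  then show ?thesis unfolding vec_axis_expansion .
qed

text \<open>The outer derivative sees the curve only through its velocity \<open>d\<close>; the
  inner one may be one-sided, as at an endpoint of the time interval.\<close>

lemma has_real_derivative_chain_vec:
  fixes f :: "real \<Rightarrow> real ^ 'n"
  assumes "\<And>i. ((\<lambda>s. f s $ i) has_real_derivative d $ i) (at t within S)"
    and "(F has_derivative D) (at (f t))"
  shows "((\<lambda>s. F (f s)) has_real_derivative D d) (at t within S)"
proof -
  have "(f has_derivative (\<lambda>r. r *\<^sub>R d)) (at t within S)"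
    using has_vector_derivative_vec[OF assms(1)] by (simp add: has_vector_derivative_def)
  from has_derivative_compose[OF this assms(2)]
  have "((\<lambda>s. F (f s)) has_derivative (\<lambda>r. D (r *\<^sub>R d))) (at t within S)" .
  moreover have "D (r *\<^sub>R d) = D d * r" for r
    using linear_scale[OF has_derivative_linear[OF assms(2)]] by simp
  ultimately show ?thesis by (simp add: has_field_derivative_def)
qed

text \<open>If \<open>\<bar>s\<bar>\<close> is below the inverse of a bound for \<open>A\<close>,
  then \<open>s A v\<close> is shorter than a nonzero \<open>v\<close> and cannot cancel it; in
  finite dimension injectivity gives bijectivity.\<close>

lemma bij_id_plus_small:
  fixes A :: "'a :: euclidean_space \<Rightarrow> 'a"
  assumes "linear A"
  shows "\<forall>\<^sub>F s in nhds 0. bij (\<lambda>v. v + s *\<^sub>R A v)"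
proof -
  obtain B where B: "B > 0" "\<And>v. norm (A v) \<le> B * norm v"
    using linear_bounded_pos[OF assms] by blast
  have "bij (\<lambda>v. v + s *\<^sub>R A v)" if s: "\<bar>s\<bar> < 1 / B" for s
  proof -
    have lin: "linear (\<lambda>v. v + s *\<^sub>R A v)"
      by (intro linear_compose_add linear_compose_scale_right linear_id[unfolded id_def] assms)
    have "v = 0" if "v + s *\<^sub>R A v = 0" for v
    proof (rule ccontr)
      assume "v \<noteq> 0"
      have "v = - (s *\<^sub>R A v)" using that by (rule eq_neg_iff_add_eq_0[THEN iffD2])
      then have "norm v = \<bar>s\<bar> * norm (A v)" by (metis norm_minus_cancel norm_scaleR)
      also have "\<dots> \<le> \<bar>s\<bar> * (B * norm v)" using B by (intro mult_left_mono) auto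
      also have "\<dots> < norm v"
        using s B \<open>v \<noteq> 0\<close> by (simp add: field_simps)
      finally show False by simp
    qed
    then have "inj (\<lambda>v. v + s *\<^sub>R A v)" unfolding linear_injective_0[OF lin] by blast
    then show ?thesis using linear_inj_imp_surj[OF lin] by (simp add: bij_def)
  qed
  then show ?thesis
    unfolding eventually_nhds_metric using B(1) by (intro exI[of _ "1 / B"]) (auto simp: dist_real_def)
qed

text \<open>By multilinearity the value is a cubic polynomial in \<open>s\<close> whose linear
  coefficient is the derivation action.\<close>

lemma has_real_derivative_pullback_at_0:
  assumes "multilinear_form 3 \<alpha>"
  shows "((\<lambda>s. \<alpha> [u + s *\<^sub>R A u, v + s *\<^sub>R A v, w + s *\<^sub>R A w]) has_real_derivative
    form_action A \<alpha> [u, v, w]) (at 0)"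
proof -
  note l = linear_3_slots[OF assms]
  have "\<alpha> [u + s *\<^sub>R A u, v + s *\<^sub>R A v, w + s *\<^sub>R A w] = \<alpha> [u, v, w] + s * form_action A \<alpha> [u, v, w]
      + s ^ 2 * (\<alpha> [A u, A v, w] + \<alpha> [A u, v, A w] + \<alpha> [u, A v, A w]) + s ^ 3 * \<alpha> [A u, A v, A w]" for s
    unfolding linear_add[OF l(1)] linear_add[OF l(2)] linear_add[OF l(3)]
      linear_scale[OF l(1)] linear_scale[OF l(2)] linear_scale[OF l(3)] form_action_apply
    by (simp add: algebra_simps power2_eq_square power3_eq_cube)
  moreover have "((\<lambda>s. a + s * b + s ^ 2 * c + s ^ 3 * d) has_real_derivative b) (at 0)" for a b c d :: real
    by (rule derivative_eq_intros refl)+ simp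
  ultimately show ?thesis by simp
qed

text \<open>
  The derivative of the metric along a path of \<open>G\<^sub>2\<close>-forms depends only on the velocity of
  the path, so it can be read off the path \<open>(id + s A)\<^sup>* \<phi>\<close> of the same velocity.
\<close>

lemma g2_metric_deriv:
  assumes "\<And>s. s \<in> S \<Longrightarrow> g2_form (\<phi> s)" "t \<in> S"
    and L: "linear L" "bij L" "\<phi> t = (\<lambda>vs. standard_g2 (map L vs))"
    and A: "linear A"
    and \<phi>: "\<And>i j k. ((\<lambda>s. component (\<phi> s) [i, j, k]) has_real_derivative
      component (form_action A (\<phi> t)) [i, j, k]) (at t within S)"
  shows "((\<lambda>s. component (g2_metric (\<phi> s)) [i, j]) has_real_derivative
    L (A (axis i 1)) \<bullet> L (axis j 1) + L (axis i 1) \<bullet> L (A (axis j 1))) (at t within S)"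
proof -
  have metric: "component (g2_metric (\<lambda>vs. standard_g2 (map K vs))) [i, j] =
      metric_coord i j (coords (\<lambda>vs. standard_g2 (map K vs)))" if "linear K" "bij K" for K
    unfolding metric_coord_coords(1)[OF that] g2_metric_pullback[OF that] by (simp add: component_def)
  define d where "d = coords (form_action A (\<phi> t))"
  obtain D where D: "(metric_coord i j has_derivative D) (at (coords (\<phi> t)))"
    using differentiable_metric_coord[OF metric_coord_coords(2)[OF L(1,2)]] unfolding L(3) differentiable_def by blast
  have coords_nth: "coords \<alpha> $ x = component \<alpha> [fst x, fst (snd x), snd (snd x)]" for \<alpha> x
    by (simp add: coords_def)
  have 1: "((\<lambda>s. metric_coord i j (coords (\<phi> s))) has_real_derivative D d) (at t within S)"
    by (rule has_real_derivative_chain_vec[where f = "\<lambda>s. coords (\<phi> s)", OF _ D]) (simp add: coords_nth d_def \<phi>)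
  define \<theta> where "\<theta> = (\<lambda>s vs. \<phi> t (map (\<lambda>v. v + s *\<^sub>R A v) vs))"
  have \<theta>0: "\<theta> 0 = \<phi> t" by (simp add: \<theta>_def)
  have m: "multilinear_form 3 (\<phi> t)"
    using assms(1)[OF assms(2)] by (simp add: g2_form_def alternating_form_multilinear)
  have \<theta>: "((\<lambda>s. component (\<theta> s) [a, b, c]) has_real_derivative component (form_action A (\<phi> t)) [a, b, c]) (at 0)" for a b c
    using has_real_derivative_pullback_at_0[OF m, of "axis a 1" A "axis b 1" "axis c 1"]
    unfolding \<theta>_def component_def list.map .
  have 2: "((\<lambda>s. metric_coord i j (coords (\<theta> s))) has_real_derivative D d) (at 0)"
    by (rule has_real_derivative_chain_vec[where f = "\<lambda>s. coords (\<theta> s)"])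
      (simp_all add: coords_nth d_def \<theta> \<theta>0 D)
  \<comment> \<open>The pullback by \<open>id + s A\<close> is known to be by an isomorphism only
    for small \<open>s\<close>, which is enough for the derivative at 0.\<close>
  have near: "\<forall>\<^sub>F s in nhds 0. metric_coord i j (coords (\<theta> s)) =
      L (axis i 1 + s *\<^sub>R A (axis i 1)) \<bullet> L (axis j 1 + s *\<^sub>R A (axis j 1))"
    using bij_id_plus_small[OF A]
  proof eventually_elim
    case (elim s)
    have lin: "linear (\<lambda>v. v + s *\<^sub>R A v)"
      by (intro linear_compose_add linear_compose_scale_right linear_id[unfolded id_def] A)
    have pullback: "\<theta> s = (\<lambda>vs. standard_g2 (map (L \<circ> (\<lambda>v. v + s *\<^sub>R A v)) vs))"
      by (simp add: \<theta>_def L(3))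
    show ?case
      unfolding pullback metric_coord_coords(1)[OF linear_compose[OF lin L(1)] bij_comp[OF elim L(2)]] by simp
  qed
  have "((\<lambda>s. L (axis i 1 + s *\<^sub>R A (axis i 1)) \<bullet> L (axis j 1 + s *\<^sub>R A (axis j 1)))
      has_real_derivative D d) (at 0)"
    using 2 unfolding DERIV_cong_ev[OF refl near refl] .
  \<comment> \<open>Along \<theta> the metric is a quadratic polynomial in \<open>s\<close>; its
    linear coefficient identifies \<open>D d\<close>.\<close>
  moreover have "((\<lambda>s. L (axis i 1 + s *\<^sub>R A (axis i 1)) \<bullet> L (axis j 1 + s *\<^sub>R A (axis j 1))) has_real_derivative
      L (A (axis i 1)) \<bullet> L (axis j 1) + L (axis i 1) \<bullet> L (A (axis j 1))) (at 0)"
    unfolding linear_add[OF L(1)] linear_scale[OF L(1)] inner_add_left inner_add_right inner_scaleR_left inner_scaleR_right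
    by (auto intro!: derivative_eq_intros)
  ultimately have "D d = L (A (axis i 1)) \<bullet> L (axis j 1) + L (axis i 1) \<bullet> L (A (axis j 1))"
    by (rule DERIV_unique)
  \<comment> \<open>\<open>metric_coord\<close> is known to give the metric only on
    \<open>g2_form\<close>s, hence the transfer to the given path is made within
    \<open>S\<close>.\<close>
  moreover have metric_s: "component (g2_metric (\<phi> s)) [i, j] = metric_coord i j (coords (\<phi> s))" if s: "s \<in> S" for s
  proof -
    obtain K where "linear K" "bij K" "\<phi> s = (\<lambda>vs. standard_g2 (map K vs))"
      using assms(1)[OF s] unfolding g2_form_def by blast
    then show ?thesis using metric[of K] by simp
  qed
  ultimately show ?thesis
    using has_derivative_transform[OF assms(2) metric_s 1[unfolded has_field_derivative_def]]
    by (simp add: has_field_derivative_def)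
qed

lemma g2_flow_pointwise:
  assumes form: "\<And>s. s \<in> S \<Longrightarrow> g2_form (\<phi> s)" and "t \<in> S" and h: "symmetric_form h"
    and flow: "\<And>i j k. ((\<lambda>s. component (\<phi> s) [i, j, k]) has_real_derivative
         (\<Sum>l\<in>UNIV. raise_index (g2_metric (\<phi> t)) h l i * component (\<phi> t) [l, j, k])
       + (\<Sum>l\<in>UNIV. raise_index (g2_metric (\<phi> t)) h l j * component (\<phi> t) [i, l, k])
       + (\<Sum>l\<in>UNIV. raise_index (g2_metric (\<phi> t)) h l k * component (\<phi> t) [i, j, l])
       + (\<Sum>l\<in>UNIV. X $ l * component (g2_dual (\<phi> t)) [l, i, j, k])) (at t within S)"
  shows "((\<lambda>s. component (g2_metric (\<phi> s)) [i, j]) has_real_derivative 2 * component h [i, j]) (at t within S)"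
proof -
  obtain L where L: "linear L" "bij L" "\<phi> t = (\<lambda>vs. standard_g2 (map L vs))"
    using form[OF \<open>t \<in> S\<close>] unfolding g2_form_def by blast
  have m: "multilinear_form 3 (\<phi> t)"
    using form[OF \<open>t \<in> S\<close>] by (simp add: g2_form_def alternating_form_multilinear)
  note lin\<phi> = linear_3_slots[OF m]
  let ?e = "\<lambda>i. axis i 1 :: real ^ 7"
  let ?g = "g2_metric (\<phi> t)"
  \<comment> \<open>Column \<open>i\<close> of the matrix holds \<open>h^l_i\<close>, so
    \<open>H\<close> sends \<open>e_i\<close> to the sum of the \<open>h^l_i e_l\<close>, and its
    derivation action gives the three \<open>h\<close> terms of the flow.\<close>
  define H where "H = (\<lambda>v. (\<chi> l i. raise_index ?g h l i) *v v)"
  \<comment> \<open>Conjugation by \<open>L\<close> carries the standard endomorphism, skew for the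
    dot product, to one that is skew for the metric of \<open>\<phi> t\<close>.\<close>
  define N where "N = (\<lambda>v. inv L (g2_endo (L X) (L v)))"
  define A where "A = (\<lambda>v. H v + N v)"
  have LN: "L (N v) = g2_endo (L X) (L v)" for v
    unfolding N_def using L(2) by (simp add: bij_is_surj surj_f_inv_f)
  have invL: "linear (inv L)" using L(1,2) by (simp add: inj_linear_imp_inv_linear bij_is_inj)
  have "linear N"
    unfolding N_def
    using linear_compose[OF linear_compose[OF L(1) linear_g2_endo(1)] invL] by (simp add: o_def)
  moreover have "linear H" by (simp add: H_def)
  ultimately have A: "linear A" unfolding A_def by (intro linear_compose_add)
  have He: "H (?e i) = (\<Sum>l\<in>UNIV. raise_index ?g h l i *\<^sub>R ?e l)" for i
    unfolding H_def
    by (simp add: vec_eq_iff matrix_vector_mult_def axis_def if_distrib cong: if_cong)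
  have dual: "(\<Sum>l\<in>UNIV. X $ l * component (g2_dual (\<phi> t)) [l, i, j, k]) =
      \<phi> t [N (?e i), ?e j, ?e k] + \<phi> t [?e i, N (?e j), ?e k] + \<phi> t [?e i, ?e j, N (?e k)]" for i j k
  proof -
    have lin: "linear (\<lambda>v. std_dual [v, L (?e i), L (?e j), L (?e k)])"
      using multilinear_form_linear[OF alternating_form_multilinear[OF alternating_form_std_dual], of "[]" "[_, _, _]"]
      by simp
    have "(\<Sum>l\<in>UNIV. X $ l * component (g2_dual (\<phi> t)) [l, i, j, k]) =
        (\<Sum>l\<in>UNIV. X $ l * std_dual [L (?e l), L (?e i), L (?e j), L (?e k)])"
      unfolding L(3) component_def by (subst g2_dual_pullback[OF L(1,2)]) simp_all
    also have "\<dots> = std_dual [L (\<Sum>l\<in>UNIV. X $ l *\<^sub>R ?e l), L (?e i), L (?e j), L (?e k)]"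
      by (simp add: linear_sum[OF L(1)] linear_scale[OF L(1)] linear_sum[OF lin] linear_scale[OF lin])
    also have "\<dots> = interior_prod (L X) std_dual [L (?e i), L (?e j), L (?e k)]"
      unfolding vec_axis_expansion interior_prod_def ..
    finally show ?thesis
      unfolding interior_prod_std_dual form_action_apply by (simp add: L(3) LN)
  qed
  have action: "component (form_action A (\<phi> t)) [i, j, k] =
         (\<Sum>l\<in>UNIV. raise_index ?g h l i * component (\<phi> t) [l, j, k])
       + (\<Sum>l\<in>UNIV. raise_index ?g h l j * component (\<phi> t) [i, l, k])
       + (\<Sum>l\<in>UNIV. raise_index ?g h l k * component (\<phi> t) [i, j, l])
       + (\<Sum>l\<in>UNIV. X $ l * component (g2_dual (\<phi> t)) [l, i, j, k])" for i j k
    unfolding dual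
    by (simp add: component_def form_action_apply A_def linear_add[OF lin\<phi>(1)] linear_add[OF lin\<phi>(2)] linear_add[OF lin\<phi>(3)]
        He linear_sum[OF lin\<phi>(1)] linear_sum[OF lin\<phi>(2)] linear_sum[OF lin\<phi>(3)]
        linear_scale[OF lin\<phi>(1)] linear_scale[OF lin\<phi>(2)] linear_scale[OF lin\<phi>(3)])
  \<comment> \<open>The raised index is lowered again: \<open>g_jl g^lm h_im = h_ij\<close>.\<close>
  have LH: "L (H (?e i)) \<bullet> L (?e j) = component h [i, j]" for i j
  proof -
    have g: "component ?g [a, b] = L (?e a) \<bullet> L (?e b)" for a b
      unfolding L(3) g2_metric_pullback[OF L(1,2)] by (simp add: component_def)
    have inv: "(\<Sum>l\<in>UNIV. component ?g [j, l] * inv_metric ?g l m) = (if j = m then 1 else 0)" for m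
      unfolding L(3) g2_metric_pullback[OF L(1,2)] by (rule inv_metric_pullback(2)[OF L(1,2)])
    have "L (H (?e i)) \<bullet> L (?e j) = (\<Sum>l\<in>UNIV. raise_index ?g h l i * component ?g [j, l])"
      by (simp add: He linear_sum[OF L(1)] linear_scale[OF L(1)] inner_sum_left g inner_commute[of "L (?e j)"])
    also have "\<dots> = (\<Sum>l\<in>UNIV. \<Sum>m\<in>UNIV. component ?g [j, l] * inv_metric ?g l m * component h [i, m])"
      by (simp add: raise_index_def sum_distrib_left sum_distrib_right mult_ac)
    also have "\<dots> = (\<Sum>m\<in>UNIV. (\<Sum>l\<in>UNIV. component ?g [j, l] * inv_metric ?g l m) * component h [i, m])"
      by (subst sum.swap) (simp add: sum_distrib_right)
    also have "\<dots> = component h [i, j]"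
      unfolding inv by (simp add: if_distrib[where f = "\<lambda>x. x * _"] cong: if_cong)
    finally show ?thesis .
  qed
  \<comment> \<open>Symmetry turns \<open>h_ij + h_ji\<close> into \<open>2 h_ij\<close>, while the
    two contributions of \<open>N\<close> cancel by skewness.\<close>
  have "component h [j, i] = component h [i, j]"
    using h by (simp add: symmetric_form_def component_def)
  then have "L (A (?e i)) \<bullet> L (?e j) + L (?e i) \<bullet> L (A (?e j)) = 2 * component h [i, j]"
    using LH[of i j] LH[of j i] inner_g2_endo_skew[of "L X" "L (?e i)" "L (?e j)"]
    by (simp add: A_def linear_add[OF L(1)] inner_add_left inner_add_right LN inner_commute)
  moreover have "((\<lambda>s. component (\<phi> s) [i, j, k]) has_real_derivative
      component (form_action A (\<phi> t)) [i, j, k]) (at t within S)" for i j k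
    unfolding action by (rule flow)
  ultimately show ?thesis
    using g2_metric_deriv[where \<phi> = \<phi>, OF form \<open>t \<in> S\<close> L A, of i j] by simp
qed

text \<open>The flow contains no spatial derivative, so at a fixed chart and point it concerns one
  curve of forms on a single vector space.\<close>

theorem corollary3p2:
  fixes M :: "'m topology" and A :: "'m chart set" and I :: "real set"
    and \<phi> h :: "real \<Rightarrow> 'm chart \<Rightarrow> 'm \<Rightarrow> tensor"
    and X :: "real \<Rightarrow> 'm chart \<Rightarrow> 'm \<Rightarrow> real ^ 7"
  assumes "smooth_7_manifold M A"
    and "is_interval I" and "interior I \<noteq> {}"
    and "smooth_g2_family A I \<phi>"
    and "\<forall>t\<in>I. symmetric_2_tensor_field A (h t)"
    and "\<forall>t\<in>I. vector_field A (X t)"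
    and flow: "\<forall>t\<in>I. \<forall>c\<in>A. \<forall>p\<in>fst c. \<forall>i j k.
      ((\<lambda>s. component (\<phi> s c p) [i, j, k]) has_real_derivative
         (\<Sum>l\<in>UNIV. raise_index (g2_metric (\<phi> t c p)) (h t c p) l i * component (\<phi> t c p) [l, j, k])
       + (\<Sum>l\<in>UNIV. raise_index (g2_metric (\<phi> t c p)) (h t c p) l j * component (\<phi> t c p) [i, l, k])
       + (\<Sum>l\<in>UNIV. raise_index (g2_metric (\<phi> t c p)) (h t c p) l k * component (\<phi> t c p) [i, j, l])
       + (\<Sum>l\<in>UNIV. X t c p $ l * component (g2_dual (\<phi> t c p)) [l, i, j, k])) (at t within I)"
  shows "\<forall>t\<in>I. \<forall>c\<in>A. \<forall>p\<in>fst c. \<forall>i j.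
      ((\<lambda>s. component (g2_metric (\<phi> s c p)) [i, j]) has_real_derivative
         2 * component (h t c p) [i, j]) (at t within I)"
proof (intro ballI allI)
  fix t c p i j assume t: "t \<in> I" and c: "c \<in> A" and p: "p \<in> fst c"
  show "((\<lambda>s. component (g2_metric (\<phi> s c p)) [i, j]) has_real_derivative
         2 * component (h t c p) [i, j]) (at t within I)"
  proof (rule g2_flow_pointwise)
    show "g2_form (\<phi> s c p)" if "s \<in> I" for s
      using assms(4) that c p by (simp add: smooth_g2_family_def)
    show "symmetric_form (h t c p)"
      using assms(5) t c p by (simp add: symmetric_2_tensor_field_def)
  qed (use flow t c p in blast)+
qed

end
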